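(* For every $C_0<\infty$ there is a constant $C<\infty$, depending only on $C_0$, such that the following holds. Let $\beta\in[0,\infty)$, $\varepsilon_0\in(0,1]$, $\delta\in[0,1]$, and suppose the candidate-ability distribution $F$, with associated gaps, is $(\beta,\varepsilon_0,\delta)$-clustered with constant $C_0$. Then for all $T\in\mathbb N$ and all $B\in[T]$, the regret of the CwG policy in the multisecretary problem satisfies $$\mathrm{Regret}(B,T;\mathrm{CwG})\le C\Big(1+\frac1\beta\Big)(\log T)^{\frac12+\frac{1}{2(\beta+1)}}\,T^{\frac12-\frac{1}{2(\beta+1)}}\,\mathbf 1\{\beta>0\}+C(\log T)^2\,\mathbf 1\{\beta=0\}+C\delta\sqrt{T\log T}+\frac{C\sqrt{\log(1/\varepsilon_0)}}{\varepsilon_0}.$$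
   Context: Multisecretary problem: horizon $T\in\mathbb N$, hiring budget $B\in[T]=\{1,\dots,T\}$. Abilities $\theta_1,\dots,\theta_T\in[0,1]$ are i.i.d. from a known distribution with CDF $F$. At each time $t$, after observing $\theta_t$, the decision maker irrevocably accepts ($a_t=1$) or rejects ($a_t=0$); at most $B$ acceptances in total; policies may be randomized and must be non-anticipating. $\mathrm{Regret}(B,T;\pi)=\mathbb E\big[\max\{\sum_t\theta_t a_t:a\in\{0,1\}^T,\sum_t a_t\le B\}\big]-\mathbb E[\sum_t\theta_t a_t^\pi]$. Clustered distributions: let $F^{-1}(q)=\inf\{v:F(v)\ge q\}$. $F$ is $(\beta,\varepsilon_0,\delta)$-clustered (with constant $C_0$) if there exist $n\in\mathbb N\cup\{0\}$ and gap quantiles $q_0^\star=0<q_1^\star<\dots<q_n^\star<q_{n+1}^\star=1$ such that (a) for all $i\in\{1,\dots,n+1\}$ and $q,\tilde q\in(q_{i-1}^\star,q_i^\star]$, $|F^{-1}(q)-F^{-1}(\tilde q)|\le C_0|q-\tilde q|^{1/(\beta+1)}+\delta$; (b) $q_i^\star-q_{i-1}^\star\ge\varepsilon_0$ for all $i\in\{1,\dots,n+1\}$. The associated gaps are $G_i=(F^{-1}(q_i^\star),F^{-1}((q_i^\star)^+))=:(a_i,b_i)$, $i\in\{1,\dots,n\}$ (so $q_i^\star=F(a_i)=F(b_i^-)$ when $G_i\neq\emptyset$). CwG policy (inputs $T,B,F,\varepsilon_0$ and $q_1^\star,\dots,q_n^\star$): set $B_1=B$ and $\tilde T=\max\{0,T-\lfloor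 64\log(1/\varepsilon_0)/\varepsilon_0^2\rfloor\}$. Phase 1, $t=1,\dots,\tilde T$: let $p_t^{CE}=1-\frac{B_t}{T-t+1}$ and $\mathcal S_t=\{i:|p_t^{CE}-q_i^\star|\le\sqrt{2\log(T-t+1)/(T-t+1)}\}$. If $\mathcal S_t=\emptyset$ set $p_t^{CwG}=p_t^{CE}$; otherwise set $p_t^{CwG}=q_{j}^\star$ with $j\in\arg\min_{i\in\mathcal S_t}|p_t^{CE}-q_i^\star|$. Observe $\theta_t$, and draw $X_t$ uniformly at random from $\mathcal I_t=\{q\in[0,1]:F^{-1}(q)=\theta_t\}$ (its unique element if it is a singleton). If $X_t\ge p_t^{CwG}$ and $B_t>0$, accept and set $B_{t+1}=B_t-1$; otherwise reject and set $B_{t+1}=B_t$. Phase 2, $t=\tilde T+1,\dots,T$: same acceptance rule, with the fixed threshold $p_{\tilde T+1}^{CE}=1-\frac{B_{\tilde T+1}}{T-\tilde T}$ in place of $p_t^{CwG}$. *)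

theory Defs
  imports "HOL-Probability.Probability"
begin

section \<open>Regret\<close>

text \<open>
  A randomized decision process is given by a probability space carrying the abilities
  \<open>\<theta> t\<close> and the accept/reject decisions \<open>a t\<close>, for \<open>t = 1, \<dots>, T\<close>.
\<close>

definition offline_opt :: "nat \<Rightarrow> nat \<Rightarrow> (nat \<Rightarrow> real) \<Rightarrow> real" where
  "offline_opt T B \<theta> =
     Max {(\<Sum>t=1..T. \<theta> t * a t) | a. a \<in> {1..T} \<rightarrow>\<^sub>E {0, 1} \<and> (\<Sum>t=1..T. a t) \<le> real B}"

definition regret ::
    "'w measure \<Rightarrow> nat \<Rightarrow> nat \<Rightarrow> (nat \<Rightarrow> 'w \<Rightarrow> real) \<Rightarrow> (nat \<Rightarrow> 'w \<Rightarrow> bool) \<Rightarrow> real" where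
  "regret M T B \<theta> a =
     (\<integral>\<omega>. offline_opt T B (\<lambda>t. \<theta> t \<omega>) \<partial>M) - (\<integral>\<omega>. (\<Sum>t=1..T. \<theta> t \<omega> * of_bool (a t \<omega>)) \<partial>M)"


section \<open>Clustered distributions\<close>

text \<open>
  The infimum ranges over the ability interval \<open>[0,1]\<close>.  For distributions supported there this
  agrees with the infimum over all reals whenever \<open>q > 0\<close>, and it makes the quantile at \<open>q = 0\<close>
  equal to \<open>0\<close>; the infimum over all reals would be that of an unbounded set.
\<close>

definition quantile :: "real measure \<Rightarrow> real \<Rightarrow> real" where
  "quantile D q = Inf {v \<in> {0..1}. cdf D v \<ge> q}"

definition clustered_with ::
    "real \<Rightarrow> real \<Rightarrow> real \<Rightarrow> real \<Rightarrow> real measure \<Rightarrow> nat \<Rightarrow> (nat \<Rightarrow> real) \<Rightarrow> bool" where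
  "clustered_with C0 \<beta> \<epsilon>0 \<delta> D n qs \<longleftrightarrow>
     qs 0 = 0 \<and> qs (n + 1) = 1 \<and> (\<forall>i\<in>{1..n+1}. qs (i - 1) < qs i) \<and>
     (\<forall>i\<in>{1..n+1}. \<forall>q\<in>{qs (i - 1)<..qs i}. \<forall>q'\<in>{qs (i - 1)<..qs i}.
        \<bar>quantile D q - quantile D q'\<bar> \<le> C0 * \<bar>q - q'\<bar> powr (1 / (\<beta> + 1)) + \<delta>) \<and>
     (\<forall>i\<in>{1..n+1}. qs i - qs (i - 1) \<ge> \<epsilon>0)"


section \<open>The CwG policy\<close>

definition phase1_length :: "nat \<Rightarrow> real \<Rightarrow> nat" where
  "phase1_length T \<epsilon>0 = nat (max 0 (int T - \<lfloor>64 * ln (1 / \<epsilon>0) / \<epsilon>0\<^sup>2\<rfloor>))"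

definition p_CE :: "nat \<Rightarrow> nat \<Rightarrow> nat \<Rightarrow> real" where
  "p_CE T t b = 1 - real b / (real T - real t + 1)"

definition near_gaps :: "nat \<Rightarrow> nat \<Rightarrow> (nat \<Rightarrow> real) \<Rightarrow> nat \<Rightarrow> nat \<Rightarrow> nat set" where
  "near_gaps T n qs t b =
     {i \<in> {1..n}. \<bar>p_CE T t b - qs i\<bar> \<le> sqrt (2 * ln (real T - real t + 1) / (real T - real t + 1))}"

text \<open>
  \<open>p t b\<close> is a Phase 1 threshold for period \<open>t\<close> with remaining budget \<open>b\<close>.  It is specified by a
  predicate rather than a function because ties between nearest gap quantiles may be broken in
  any way.
\<close>

definition CwG_threshold_rule ::
    "nat \<Rightarrow> nat \<Rightarrow> (nat \<Rightarrow> real) \<Rightarrow> (nat \<Rightarrow> nat \<Rightarrow> real) \<Rightarrow> bool" where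
  "CwG_threshold_rule T n qs p \<longleftrightarrow>
     (\<forall>t\<in>{1..T}. \<forall>b.
        if near_gaps T n qs t b = {} then p t b = p_CE T t b
        else \<exists>j. is_arg_min (\<lambda>i. \<bar>p_CE T t b - qs i\<bar>) (\<lambda>i. i \<in> near_gaps T n qs t b) j \<and>
                 p t b = qs j)"

text \<open>
  \<open>CwG_budget \<dots> x t\<close> is the budget at the start of period \<open>t \<ge> 1\<close> along the draws
  \<open>x 1, x 2, \<dots>\<close>; the value at \<open>t = 0\<close> is a dummy.
\<close>

function CwG_budget ::
    "nat \<Rightarrow> nat \<Rightarrow> real \<Rightarrow> (nat \<Rightarrow> nat \<Rightarrow> real) \<Rightarrow> (nat \<Rightarrow> real) \<Rightarrow> nat \<Rightarrow> nat"
  and CwG_threshold ::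
    "nat \<Rightarrow> nat \<Rightarrow> real \<Rightarrow> (nat \<Rightarrow> nat \<Rightarrow> real) \<Rightarrow> (nat \<Rightarrow> real) \<Rightarrow> nat \<Rightarrow> real" where
  "CwG_budget T B \<epsilon>0 p x 0 = B"
| "CwG_budget T B \<epsilon>0 p x (Suc 0) = B"
| "CwG_budget T B \<epsilon>0 p x (Suc (Suc t)) =
     (if x (Suc t) \<ge> CwG_threshold T B \<epsilon>0 p x (Suc t) \<and> CwG_budget T B \<epsilon>0 p x (Suc t) > 0
      then CwG_budget T B \<epsilon>0 p x (Suc t) - 1
      else CwG_budget T B \<epsilon>0 p x (Suc t))"
| "CwG_threshold T B \<epsilon>0 p x t =
     (if t \<le> phase1_length T \<epsilon>0
      then p t (CwG_budget T B \<epsilon>0 p x t)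
      else p_CE T (phase1_length T \<epsilon>0 + 1) (CwG_budget T B \<epsilon>0 p x (phase1_length T \<epsilon>0 + 1)))"
  by pat_completeness auto
termination
  by (relation "Wellfounded.measure (\<lambda>s. case s of Inl (T, B, \<epsilon>0, p, x, t) \<Rightarrow> 2 * t
                                     | Inr (T, B, \<epsilon>0, p, x, t) \<Rightarrow> 2 * t + 1)") auto

definition CwG_accepts ::
    "nat \<Rightarrow> nat \<Rightarrow> real \<Rightarrow> (nat \<Rightarrow> nat \<Rightarrow> real) \<Rightarrow> (nat \<Rightarrow> real) \<Rightarrow> nat \<Rightarrow> bool" where
  "CwG_accepts T B \<epsilon>0 p x t \<longleftrightarrow>
     x t \<ge> CwG_threshold T B \<epsilon>0 p x t \<and> CwG_budget T B \<epsilon>0 p x t > 0"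

text \<open>
  The conditional law of the draw \<open>X\<^sub>t\<close> given \<open>\<theta>\<^sub>t = v\<close>.  The set of quantile levels of \<open>v\<close> is
  an interval; it is empty (and the law below is then the null measure) only for \<open>v\<close> in a set
  of probability zero.
\<close>

definition quantile_draw :: "real measure \<Rightarrow> real \<Rightarrow> real measure" where
  "quantile_draw D v =
     (let I = {q \<in> {0..1}. quantile D q = v}
      in if is_singleton I then return borel (the_elem I) else uniform_measure lborel I)"

definition ability_draw_law :: "real measure \<Rightarrow> (real \<times> real) measure" where
  "ability_draw_law D =
     D \<bind> (\<lambda>v. distr (quantile_draw D v) (borel \<Otimes>\<^sub>M borel) (\<lambda>q. (v, q)))"

text \<open>Independent pairs \<open>\<omega> t = (\<theta>\<^sub>t, X\<^sub>t)\<close>, \<open>t = 1, \<dots>, T\<close>.\<close>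

definition CwG_space :: "real measure \<Rightarrow> nat \<Rightarrow> (nat \<Rightarrow> real \<times> real) measure" where
  "CwG_space D T = (\<Pi>\<^sub>M t\<in>{1..T}. ability_draw_law D)"

definition CwG_regret ::
    "real measure \<Rightarrow> nat \<Rightarrow> nat \<Rightarrow> real \<Rightarrow> (nat \<Rightarrow> nat \<Rightarrow> real) \<Rightarrow> real" where
  "CwG_regret D T B \<epsilon>0 p =
     regret (CwG_space D T) T B
       (\<lambda>t \<omega>. fst (\<omega> t)) (\<lambda>t \<omega>. CwG_accepts T B \<epsilon>0 p (\<lambda>s. snd (\<omega> s)) t)"

end

theory Submission
  imports Defs
begin

text \<open>
  Write \<open>Q\<close> for the quantile function.  Since \<open>Q\<close> applied to a uniform variable has the law of the
  abilities, and the randomized level \<open>X\<^sub>t\<close> inverts this transform, the pairs \<open>(\<theta>\<^sub>t, X\<^sub>t)\<close> can be taken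
  to be \<open>(Q X\<^sub>t, X\<^sub>t)\<close> with \<open>X\<^sub>1, \<dots>, X\<^sub>T\<close> independent and uniform (\<open>ability_draw_law_eq\<close>).  All of the
  randomness then sits in quantile space, where the policy compares \<open>X\<^sub>t\<close> with a threshold.

  Let \<open>V\<^sub>t(b)\<close> be the sum of the \<open>b\<close> largest abilities among periods \<open>t, \<dots>, T\<close>.  Following \<open>V\<^sub>t(B\<^sub>t)\<close>
  along the budget path of the policy writes the regret as a sum of per-period losses, and an
  exchange argument controls each of them.  If the policy accepts \<open>t\<close>, hindsight could at best have
  swapped \<open>t\<close> for some later \<open>s\<close> of level at most \<open>u\<close>, as soon as fewer than \<open>b\<close> later levels exceed
  \<open>u\<close>; if it rejects \<open>t\<close>, some unused later \<open>s\<close> of level at least \<open>l\<close> replaces \<open>t\<close>, as soon as at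
  least \<open>b\<close> later levels reach \<open>l\<close>.  With \<open>N = T - t + 1\<close>, \<open>r = sqrt (2 ln N / N)\<close>, and \<open>u\<close>, \<open>l\<close> equal
  to the certainty-equivalent threshold plus and minus \<open>r\<close>, Hoeffding's inequality makes both
  conditions hold up to probability \<open>2 / N\<^sup>2\<close>.  The loss is then a difference of values of \<open>Q\<close> at two
  levels lying between the policy's threshold and \<open>u\<close> or \<open>l\<close>.  This is where conservativeness with
  respect to gaps enters: the threshold is either \<open>r\<close>-far from every gap quantile, or it is itself a
  gap quantile and the next one is farther than \<open>2 r\<close> away, so in both cases the two levels belong
  to one cluster (\<open>no_gap_above_threshold\<close>, \<open>no_gap_below_threshold\<close>) and the loss is at most
  \<open>\<bar>C0\<bar> (2 r) powr (1 / (\<beta> + 1)) + \<delta>\<close>.  It vanishes unless \<open>X\<^sub>t\<close> is within \<open>2 r\<close> of the threshold, an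
  event of probability at most \<open>4 r\<close>.  Hence the expected loss is of order
  \<open>(ln N / N) powr (1/2 + 1/(2 (\<beta> + 1))) + \<delta> sqrt (ln N / N) + 1 / N\<^sup>2\<close>, and summing over \<open>N\<close> gives
  the terms of the bound that depend on \<open>T\<close>.

  The second phase has \<open>m\<close> periods with \<open>m \<le> 64 ln (1 / \<epsilon>0) / \<epsilon>0\<^sup>2\<close> and a fixed threshold.  Its loss
  is at most the deviation of the number of acceptable candidates from the remaining budget
  (\<open>phase2_path\<close>), whose mean is at most \<open>sqrt m\<close>; this is the last term of the bound.

  The budget \<open>B\<^sub>t\<close> is a function of \<open>X\<^sub>1, \<dots>, X\<^bsub>t-1\<^esub>\<close>, hence independent of the levels that enter the
  loss in period \<open>t\<close>, so it suffices to bound expected losses for each fixed value of the budget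
  (\<open>expectation_decoupled\<close>).
\<close>

section \<open>Quantile transform\<close>

lemma bdd_below_quantile_set: "bdd_below {v \<in> {0..1::real}. P v}"
  by (rule bdd_belowI[of _ 0]) auto

locale unit_distribution = real_distribution D for D :: "real measure" +
  assumes unit_mass: "measure D {0..1} = 1"
begin

lemma cdf_one: "cdf D 1 = 1"
proof -
  have "measure D {0..1} \<le> measure D {..1}" by (rule finite_measure_mono) auto
  then show ?thesis using unit_mass prob_le_1[of "{..1}"] by (simp add: cdf_def)
qed

lemma cdf_ge_one: "1 \<le> x \<Longrightarrow> cdf D x = 1"
  using cdf_nondecreasing[of 1 x] cdf_one cdf_bounded_prob[of x] by simp

lemma cdf_neg: "x < 0 \<Longrightarrow> cdf D x = 0"
proof -
  assume x: "x < 0"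
  have "measure D ({..x} \<union> {0..1}) = measure D {..x} + measure D {0..1}"
    by (rule finite_measure_Union) (use x in auto)
  then show ?thesis using unit_mass prob_le_1[of "{..x} \<union> {0..1}"] measure_nonneg[of D "{..x}"]
    by (simp add: cdf_def)
qed

text \<open>
  The Galois connection between \<open>quantile D\<close> and \<open>cdf D\<close>.  Right continuity of the distribution
  function makes the infimum in the quantile a minimum; every other property of \<open>quantile D\<close> used
  below follows from this equivalence.
\<close>

lemma quantile_le_iff:
  assumes q: "q \<le> 1" and v: "0 \<le> v" "v \<le> 1"
  shows "quantile D q \<le> v \<longleftrightarrow> q \<le> cdf D v"
proof
  assume "q \<le> cdf D v"
  then show "quantile D q \<le> v"
    unfolding quantile_def by (intro cInf_lower bdd_below_quantile_set) (use v in auto)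
next
  let ?S = "{v \<in> {0..1}. q \<le> cdf D v}"
  assume *: "quantile D q \<le> v"
  have ne: "?S \<noteq> {}" using cdf_one q by (auto intro!: exI[of _ 1])
  have "q \<le> (INF s\<in>?S. cdf D s)" by (rule cINF_greatest[OF ne]) auto
  also have "\<dots> = cdf D (Inf ?S)"
    by (rule continuous_at_Inf_mono[symmetric, OF _ cdf_is_right_cont ne bdd_below_quantile_set])
       (auto intro!: monoI cdf_nondecreasing)
  also have "\<dots> \<le> cdf D v" using * by (intro cdf_nondecreasing) (simp add: quantile_def)
  finally show "q \<le> cdf D v" .
qed

lemma quantile_nonneg: "q \<le> 1 \<Longrightarrow> 0 \<le> quantile D q"
  unfolding quantile_def using cdf_one by (intro cInf_greatest) (auto intro!: exI[of _ 1])

lemma quantile_le_one: "q \<le> 1 \<Longrightarrow> quantile D q \<le> 1"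
  using quantile_le_iff[of q 1] cdf_one by simp

lemma quantile_mono: "q \<le> q' \<Longrightarrow> q' \<le> 1 \<Longrightarrow> quantile D q \<le> quantile D q'"
  using quantile_le_iff[of q "quantile D q'"] quantile_le_iff[of q' "quantile D q'"]
        quantile_nonneg[of q'] quantile_le_one[of q'] by simp

lemma quantile_measurable [measurable]: "quantile D \<in> borel_measurable borel"
proof -
  have "(\<lambda>q. quantile D (min q 1)) \<in> borel_measurable borel"
    by (intro borel_measurable_mono monoI quantile_mono) auto
  then have "(\<lambda>q. if q \<le> 1 then quantile D (min q 1) else Inf {}) \<in> borel_measurable borel"
    by simp
  also have "(\<lambda>q. if q \<le> 1 then quantile D (min q 1) else Inf {}) = quantile D"
  proof
    fix q show "(if q \<le> 1 then quantile D (min q 1) else Inf {}) = quantile D q"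
    proof (cases "q \<le> 1")
      case False
      then have "{v \<in> {0..1}. q \<le> cdf D v} = {}"
        using cdf_bounded_prob by (auto dest: order_trans)
      with False show ?thesis by (simp only: quantile_def if_False)
    qed simp
  qed
  finally show ?thesis .
qed

lemma cdf_measurable [measurable]: "cdf D \<in> borel_measurable borel"
  by (intro borel_measurable_mono monoI cdf_nondecreasing)

end

text \<open>
  The open interval avoids the levels \<open>0\<close> and \<open>1\<close>: the quantile at \<open>0\<close> is \<open>0\<close> by convention, and may
  lie far below the quantiles at small positive levels.
\<close>

definition unif :: "real measure" where
  "unif = uniform_measure lborel {0<..<1}"

lemma space_unif [simp]: "space unif = UNIV" and sets_unif [simp, measurable_cong]: "sets unif = sets borel"
  by (auto simp: unif_def)

lemma prob_space_unif: "prob_space unif"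
  unfolding unif_def by (rule prob_space_uniform_measure) auto

lemma measure_unif: "A \<in> sets borel \<Longrightarrow> measure unif A = measure lborel ({0<..<1} \<inter> A)"
  unfolding unif_def by (subst measure_uniform_measure) auto

lemma emeasure_unif: "A \<in> sets borel \<Longrightarrow> emeasure unif A = emeasure lborel ({0<..<1} \<inter> A)"
  unfolding unif_def by (subst emeasure_uniform_measure) (auto simp: divide_ennreal_def)

lemma AE_unif: "AE q in unif. 0 < q \<and> q < 1"
  unfolding unif_def by (rule AE_uniform_measureI) auto

lemma unif_atMost: "0 \<le> c \<Longrightarrow> c \<le> 1 \<Longrightarrow> measure unif {..c} = c"
proof -
  assume c: "0 \<le> c" "c \<le> 1"
  have "measure lborel ({0<..<1} \<inter> {..c}) = measure lborel {0<..<c}"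
    unfolding measure_def
    by (intro arg_cong[where f=enn2real] emeasure_eq_AE) (use c AE_lborel_singleton[of c] in auto)
  then show ?thesis using c by (simp add: measure_unif)
qed

context unit_distribution
begin

lemma distr_quantile_unif: "distr unif borel (quantile D) = D"
proof (rule cdf_unique)
  interpret U: prob_space unif by (rule prob_space_unif)
  show "real_distribution (distr unif borel (quantile D))" by simp
  show "real_distribution D" by (rule real_distribution_axioms)
  show "cdf (distr unif borel (quantile D)) = cdf D"
  proof
    fix x
    have "cdf (distr unif borel (quantile D)) x = measure unif {q. quantile D q \<le> x}"
      unfolding cdf_def by (subst measure_distr) (auto simp: vimage_def)
    also have "\<dots> = cdf D x"
    proof (cases "0 \<le> x \<and> x \<le> 1")
      case True
      have "measure unif {q. quantile D q \<le> x} = measure unif {..cdf D x}"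
        by (intro U.finite_measure_eq_AE) (use True AE_unif in \<open>auto simp: quantile_le_iff\<close>)
      then show ?thesis using unif_atMost[of "cdf D x"] cdf_bounded_prob[of x] cdf_nonneg[of x] by simp
    next
      case False
      show ?thesis
      proof (cases "x < 0")
        case True
        have "measure unif {q. quantile D q \<le> x} = measure unif {}"
        proof (intro U.finite_measure_eq_AE)
          show "AE q in unif. (q \<in> {q. quantile D q \<le> x}) = (q \<in> {})"
            using AE_unif
          proof eventually_elim
            case (elim q) then show ?case using True quantile_nonneg[of q] by simp
          qed
        qed auto
        then show ?thesis using cdf_neg[OF True] by simp
      next
        case F2: False
        have "measure unif {q. quantile D q \<le> x} = measure unif UNIV"
        proof (intro U.finite_measure_eq_AE)
          show "AE q in unif. (q \<in> {q. quantile D q \<le> x}) = (q \<in> UNIV)"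
            using AE_unif
          proof eventually_elim
            case (elim q) then show ?case using False F2 quantile_le_one[of q] by simp
          qed
        qed auto
        then show ?thesis using cdf_ge_one[of x] F2 False U.prob_space by simp
      qed
    qed
    finally show "cdf (distr unif borel (quantile D)) x = cdf D x" .
  qed
qed

text \<open>
  The levels of \<open>v\<close> form an interval, on which \<open>quantile_draw D v\<close> is uniform.
\<close>

definition levels :: "real \<Rightarrow> real set" where
  "levels v = {q \<in> {0..1}. quantile D q = v}"

text \<open>
  A countable set containing every \<open>v\<close> with more than one level, because an interval of levels
  contains a rational.
\<close>

definition atoms :: "real set" where
  "atoms = quantile D ` (\<rat> \<inter> {0..1})"

lemma countable_atoms: "countable atoms"
  unfolding atoms_def by (intro countable_image countable_Int1 countable_rat)

lemma levels_measurable [measurable]: "levels v \<in> sets borel"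
  unfolding levels_def by measurable

lemma levels_interval: "q \<in> levels v \<Longrightarrow> q' \<in> levels v \<Longrightarrow> q \<le> x \<Longrightarrow> x \<le> q' \<Longrightarrow> x \<in> levels v"
proof -
  assume *: "q \<in> levels v" "q' \<in> levels v" "q \<le> x" "x \<le> q'"
  then have b: "0 \<le> x" "x \<le> 1" "q' \<le> 1" and v: "quantile D q = v" "quantile D q' = v"
    unfolding levels_def by simp_all
  have "quantile D x = v"
    using quantile_mono[OF *(3) b(2)] quantile_mono[OF *(4) b(3)] unfolding v by (rule order_antisym[rotated])
  with b show "x \<in> levels v" unfolding levels_def by simp
qed

lemma levels_unique:
  assumes "v \<notin> atoms" "q \<in> levels v" "q' \<in> levels v" shows "q = q'"
proof (rule ccontr)
  assume "q \<noteq> q'"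
  have False if "a \<in> levels v" "b \<in> levels v" "a < b" for a b
  proof -
    obtain x where x: "x \<in> \<rat>" "a < x" "x < b" using Rats_dense_in_real[OF \<open>a < b\<close>] by blast
    then have "x \<in> levels v" using levels_interval[OF that(1,2)] by simp
    then show False using assms(1) x by (auto simp: atoms_def levels_def)
  qed
  from this[of q q'] this[of q' q] show False using assms \<open>q \<noteq> q'\<close> by linarith
qed

text \<open>
  A value off \<open>atoms\<close> that has a level has \<open>cdf D v\<close> as its only level; this explicit formula is what
  makes the draw measurable as a function of the ability.
\<close>

lemma cdf_in_levels:
  assumes "q \<in> levels v" shows "cdf D v \<in> levels v"
proof -
  have q: "0 \<le> q" "q \<le> 1" "quantile D q = v" using assms by (auto simp: levels_def)
  have v: "0 \<le> v" "v \<le> 1" using q quantile_nonneg quantile_le_one by blast+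
  have "q \<le> cdf D v" using quantile_le_iff[OF q(2) v] q by simp
  moreover have "quantile D (cdf D v) \<le> v" using quantile_le_iff[of "cdf D v" v] v cdf_bounded_prob by simp
  moreover have "v \<le> quantile D (cdf D v)"
    using quantile_mono[of q "cdf D v"] calculation(1) cdf_bounded_prob q by simp
  ultimately show ?thesis using q cdf_bounded_prob by (simp add: levels_def)
qed

lemma quantile_draw_singleton: "levels v = {q} \<Longrightarrow> quantile_draw D v = return borel q"
  unfolding quantile_draw_def levels_def[symmetric] by (simp add: Let_def)

lemma quantile_draw_uniform: "\<not> is_singleton (levels v) \<Longrightarrow> quantile_draw D v = uniform_measure lborel (levels v)"
  unfolding quantile_draw_def levels_def[symmetric] by (simp add: Let_def)

lemma sets_quantile_draw [simp, measurable_cong]: "sets (quantile_draw D v) = sets borel"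
  by (cases "is_singleton (levels v)") (auto simp: quantile_draw_uniform is_singleton_def quantile_draw_singleton)

lemma space_quantile_draw [simp]: "space (quantile_draw D v) = UNIV"
  using sets_eq_imp_space_eq[OF sets_quantile_draw] by simp

lemma levels_finite: "emeasure lborel (levels v) \<noteq> \<infinity>"
proof -
  have "emeasure lborel (levels v) \<le> emeasure lborel {0..1::real}"
    by (rule emeasure_mono) (auto simp: levels_def)
  also have "\<dots> < \<infinity>" by simp
  finally show ?thesis by simp
qed

lemma levels_pos:
  assumes "\<not> is_singleton (levels v)" "levels v \<noteq> {}" shows "emeasure lborel (levels v) > 0"
proof -
  obtain q where q: "q \<in> levels v" using assms(2) by blast
  moreover have "levels v \<noteq> {q}" using assms(1) by (auto simp: is_singleton_def)
  ultimately obtain q' where "q' \<in> levels v" "q' \<noteq> q" by blast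
  have pos: "emeasure lborel (levels v) > 0" if "a \<in> levels v" "b \<in> levels v" "a < b" for a b
  proof -
    have "{a..b} \<subseteq> levels v" using levels_interval[OF that(1,2)] by auto
    then have "emeasure lborel {a..b} \<le> emeasure lborel (levels v)" by (intro emeasure_mono) auto
    moreover have "0 < emeasure lborel {a..b}" using \<open>a < b\<close> by simp
    ultimately show ?thesis by (rule order_less_le_trans[rotated])
  qed
  show ?thesis using pos[of q q'] pos[of q' q] q \<open>q' \<in> levels v\<close> \<open>q' \<noteq> q\<close> by (cases "q < q'") auto
qed

lemma subprob_quantile_draw: "subprob_space (quantile_draw D v)"
proof (cases "is_singleton (levels v)")
  case True
  then show ?thesis
    by (auto simp: is_singleton_def quantile_draw_singleton intro!: prob_space_imp_subprob_space prob_space_return)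
next
  case False
  have "emeasure (uniform_measure lborel (levels v)) UNIV
      = emeasure lborel (levels v) / emeasure lborel (levels v)"
    by (subst emeasure_uniform_measure) auto
  also have "\<dots> \<le> 1"
    using levels_finite[of v] by (cases "emeasure lborel (levels v) = 0") (simp_all add: ennreal_divide_self less_top)
  finally have "emeasure (uniform_measure lborel (levels v)) UNIV \<le> 1" .
  then show ?thesis unfolding quantile_draw_uniform[OF False] by (intro subprob_spaceI) auto
qed

definition draw_kernel :: "real \<Rightarrow> (real \<times> real) measure" where
  "draw_kernel v = distr (quantile_draw D v) (borel \<Otimes>\<^sub>M borel) (\<lambda>q. (v, q))"

lemma emeasure_draw_kernel:
  "A \<in> sets (borel \<Otimes>\<^sub>M borel) \<Longrightarrow> emeasure (draw_kernel v) A = emeasure (quantile_draw D v) {q. (v, q) \<in> A}"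
  unfolding draw_kernel_def by (subst emeasure_distr) (auto simp: vimage_def)

lemma draw_kernel_off_atoms:
  assumes v: "v \<notin> atoms" and q: "q \<in> levels v" and A: "A \<in> sets (borel \<Otimes>\<^sub>M borel)"
  shows "emeasure (draw_kernel v) A = indicator A (v, q)"
proof -
  have "levels v = {q}" using levels_unique[OF v] q by auto
  note [measurable] = A
  show ?thesis
    unfolding emeasure_draw_kernel[OF A] quantile_draw_singleton[OF \<open>levels v = {q}\<close>]
    by (subst emeasure_return) (auto simp: indicator_def)
qed

lemma draw_kernel_empty:
  assumes "levels v = {}" and A: "A \<in> sets (borel \<Otimes>\<^sub>M borel)"
  shows "emeasure (draw_kernel v) A = 0"
proof -
  note [measurable] = A
  have "\<not> is_singleton (levels v)" using assms by (simp add: is_singleton_def)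
  then show ?thesis
    unfolding emeasure_draw_kernel[OF A] by (subst quantile_draw_uniform) (auto simp: assms emeasure_uniform_measure)
qed

text \<open>
  Apart from the countable set \<open>atoms\<close>, the kernel is the point mass at \<open>(v, cdf D v)\<close> or the null
  measure, and changing a function on countably many points preserves Borel measurability.
\<close>

lemma draw_kernel_measurable: "draw_kernel \<in> D \<rightarrow>\<^sub>M subprob_algebra (borel \<Otimes>\<^sub>M borel)"
proof (rule measurable_subprob_algebra)
  fix v
  show "subprob_space (draw_kernel v)"
    unfolding draw_kernel_def
    by (intro subprob_space.subprob_space_distr subprob_quantile_draw) (auto simp: space_pair_measure)
  show "sets (draw_kernel v) = sets (borel \<Otimes>\<^sub>M borel)" unfolding draw_kernel_def by simp
next
  fix A :: "(real \<times> real) set" assume A[measurable]: "A \<in> sets (borel \<Otimes>\<^sub>M borel)"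
  have "(\<lambda>v. if cdf D v \<in> {0..1} \<and> quantile D (cdf D v) = v then indicator A (v, cdf D v) else 0 :: ennreal)
        \<in> borel_measurable borel"
    by measurable
  then have "(\<lambda>v. emeasure (draw_kernel v) A) \<in> borel_measurable borel"
  proof (rule measurable_discrete_difference[OF _ countable_atoms])
    fix v assume "v \<notin> atoms"
    show "(if cdf D v \<in> {0..1} \<and> quantile D (cdf D v) = v then indicator A (v, cdf D v) else 0)
          = emeasure (draw_kernel v) A"
    proof (cases "cdf D v \<in> levels v")
      case True
      then show ?thesis using draw_kernel_off_atoms[OF \<open>v \<notin> atoms\<close> True A] by (simp add: levels_def)
    next
      case False
      then have "levels v = {}" using cdf_in_levels by blast
      from draw_kernel_empty[OF this A] False show ?thesis by (auto simp: levels_def)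
    qed
  qed auto
  then show "(\<lambda>v. emeasure (draw_kernel v) A) \<in> borel_measurable D"
    by (simp cong: measurable_cong_sets)
qed

text \<open>
  On the event that the ability equals \<open>v\<close>, redrawing the level uniformly from the levels of \<open>v\<close>
  changes nothing, because the level is already uniform there.  If \<open>v\<close> has at most one level then
  both sides are integrals over a null set.
\<close>

lemma nn_integral_draw_atom:
  assumes A: "A \<in> sets (borel \<Otimes>\<^sub>M borel)"
  shows "(\<integral>\<^sup>+q. emeasure (draw_kernel (quantile D q)) A * indicator {q. quantile D q = v} q \<partial>unif)
       = (\<integral>\<^sup>+q. indicator A (quantile D q, q) * indicator {q. quantile D q = v} q \<partial>unif)"
proof -
  note [measurable] = A
  let ?J = "{0<..<1} \<inter> {q. quantile D q = v}" and ?A = "{q. (v, q) \<in> A}"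
  have Am[measurable]: "?A \<in> sets borel" by measurable
  have lev: "AE q in lborel. q \<in> ?J \<longleftrightarrow> q \<in> levels v"
    using AE_lborel_singleton[of 0] AE_lborel_singleton[of 1]
    by eventually_elim (auto simp: levels_def)
  have "(\<integral>\<^sup>+q. emeasure (draw_kernel (quantile D q)) A * indicator {q. quantile D q = v} q \<partial>unif)
     = (\<integral>\<^sup>+q. emeasure (draw_kernel v) A * indicator {q. quantile D q = v} q \<partial>unif)"
    by (intro nn_integral_cong) (auto simp: indicator_def)
  also have "\<dots> = emeasure (quantile_draw D v) ?A * emeasure lborel ?J"
    by (subst nn_integral_cmult_indicator) (auto simp: emeasure_unif emeasure_draw_kernel[OF A])
  also have "emeasure lborel ?J = emeasure lborel (levels v)"
    by (rule emeasure_eq_AE[OF lev]) auto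
  also have "emeasure (quantile_draw D v) ?A * emeasure lborel (levels v) = emeasure lborel (levels v \<inter> ?A)"
  proof (cases "is_singleton (levels v) \<or> levels v = {}")
    case True
    then obtain q where "levels v \<subseteq> {q}" by (auto simp: is_singleton_def)
    then have "emeasure lborel (levels v) \<le> emeasure lborel {q}" "emeasure lborel (levels v \<inter> ?A) \<le> emeasure lborel {q}"
      using emeasure_mono[of "levels v" "{q}" lborel] emeasure_mono[of "levels v \<inter> ?A" "{q}" lborel] by auto
    then have "emeasure lborel (levels v) = 0" "emeasure lborel (levels v \<inter> ?A) = 0" by simp_all
    then show ?thesis by simp
  next
    case False
    then have "emeasure lborel (levels v) > 0" using levels_pos by blast
    moreover have "emeasure (quantile_draw D v) ?A = emeasure lborel (levels v \<inter> ?A) / emeasure lborel (levels v)"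
      using False by (subst quantile_draw_uniform) (simp_all add: emeasure_uniform_measure)
    ultimately show ?thesis using levels_finite[of v]
      by (simp add: ennreal_divide_times ennreal_divide_self less_top zero_less_iff_neq_zero)
  qed
  also have "\<dots> = emeasure lborel (?J \<inter> ?A)"
  proof (rule emeasure_eq_AE)
    show "AE q in lborel. (q \<in> levels v \<inter> ?A) = (q \<in> ?J \<inter> ?A)"
      using lev by eventually_elim blast
  qed auto
  also have "?J \<inter> ?A = {0<..<1} \<inter> ({q. quantile D q = v} \<inter> ?A)" by blast
  also have "emeasure lborel \<dots> = emeasure unif ({q. quantile D q = v} \<inter> ?A)"
    by (subst emeasure_unif) auto
  also have "\<dots> = (\<integral>\<^sup>+q. indicator ({q. quantile D q = v} \<inter> ?A) q \<partial>unif)"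
    by (subst nn_integral_indicator) auto
  also have "\<dots> = (\<integral>\<^sup>+q. indicator A (quantile D q, q) * indicator {q. quantile D q = v} q \<partial>unif)"
    by (intro nn_integral_cong) (auto simp: indicator_def)
  finally show ?thesis .
qed

text \<open>
  The randomized level inverts the quantile transform.  The two laws are compared separately off
  \<open>atoms\<close>, where the ability determines the level, and on each of the countably many atoms.
\<close>

theorem ability_draw_law_eq:
  "ability_draw_law D = distr unif (borel \<Otimes>\<^sub>M borel) (\<lambda>q. (quantile D q, q))"
proof (rule measure_eqI)
  have kern: "ability_draw_law D = D \<bind> draw_kernel"
    unfolding ability_draw_law_def draw_kernel_def ..
  have ne: "space D \<noteq> {}" by simp
  show "sets (ability_draw_law D) = sets (distr unif (borel \<Otimes>\<^sub>M borel) (\<lambda>q. (quantile D q, q)))"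
    unfolding kern using sets_bind_measurable[OF draw_kernel_measurable ne] by simp
  fix A assume "A \<in> sets (ability_draw_law D)"
  then have A[measurable]: "A \<in> sets (borel \<Otimes>\<^sub>M borel)"
    unfolding kern using sets_bind_measurable[OF draw_kernel_measurable ne] by simp
  have km[measurable]: "(\<lambda>v. emeasure (draw_kernel v) A) \<in> borel_measurable borel"
    using measurable_emeasure_kernel[OF draw_kernel_measurable A] by (simp cong: measurable_cong_sets)
  define f where "f q = emeasure (draw_kernel (quantile D q)) A" for q
  define g :: "real \<Rightarrow> ennreal" where "g q = indicator A (quantile D q, q)" for q
  have [measurable]: "f \<in> borel_measurable borel" "g \<in> borel_measurable borel"
    unfolding f_def g_def by measurable
  have pair: "(\<lambda>q. (quantile D q, q)) \<in> unif \<rightarrow>\<^sub>M borel \<Otimes>\<^sub>M borel" by measurable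
  have [measurable]: "quantile D -` atoms \<in> sets borel"
    using measurable_sets[OF quantile_measurable, of atoms] countable_atoms by (simp add: sets.countable)
  have split: "(\<integral>\<^sup>+q. h q \<partial>unif) = (\<integral>\<^sup>+q. h q * indicator (- quantile D -` atoms) q \<partial>unif)
       + (\<integral>\<^sup>+v. (\<integral>\<^sup>+q. h q * indicator {q. quantile D q = v} q \<partial>unif) \<partial>count_space atoms)"
    if [measurable]: "h \<in> borel_measurable borel" for h :: "real \<Rightarrow> ennreal"
  proof -
    have pt: "(\<integral>\<^sup>+v. h q * indicator {q. quantile D q = v} q \<partial>count_space atoms)
        = h q * indicator (quantile D -` atoms) q" for q
    proof (cases "quantile D q \<in> atoms")
      case True
      have "(\<integral>\<^sup>+v. h q * indicator {q. quantile D q = v} q \<partial>count_space atoms)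
          = (\<Sum>v\<in>{quantile D q}. h q * indicator {q. quantile D q = v} q)"
        by (rule nn_integral_count_space') (use True in \<open>auto simp: indicator_def\<close>)
      then show ?thesis using True by (simp add: indicator_def)
    next
      case False
      have "(\<integral>\<^sup>+v. h q * indicator {q. quantile D q = v} q \<partial>count_space atoms)
          = (\<Sum>v\<in>{}. h q * indicator {q. quantile D q = v} q)"
        by (rule nn_integral_count_space') (use False in \<open>auto simp: indicator_def\<close>)
      then show ?thesis using False by (simp add: indicator_def)
    qed
    have "(\<integral>\<^sup>+q. h q \<partial>unif) = (\<integral>\<^sup>+q. h q * indicator (- quantile D -` atoms) q
        + h q * indicator (quantile D -` atoms) q \<partial>unif)"
      by (rule nn_integral_cong) (simp add: indicator_def)
    also have "\<dots> = (\<integral>\<^sup>+q. h q * indicator (- quantile D -` atoms) q \<partial>unif)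
        + (\<integral>\<^sup>+q. h q * indicator (quantile D -` atoms) q \<partial>unif)"
      by (rule nn_integral_add) measurable
    also have "(\<integral>\<^sup>+q. h q * indicator (quantile D -` atoms) q \<partial>unif)
       = (\<integral>\<^sup>+q. (\<integral>\<^sup>+v. h q * indicator {q. quantile D q = v} q \<partial>count_space atoms) \<partial>unif)"
      unfolding pt ..
    also have "\<dots> = (\<integral>\<^sup>+v. (\<integral>\<^sup>+q. h q * indicator {q. quantile D q = v} q \<partial>unif) \<partial>count_space atoms)"
      by (rule nn_integral_count_space_nn_integral[OF countable_atoms]) measurable
    finally show ?thesis .
  qed
  have "emeasure (ability_draw_law D) A = (\<integral>\<^sup>+v. emeasure (draw_kernel v) A \<partial>D)"
    unfolding kern by (rule emeasure_bind[OF ne draw_kernel_measurable A])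
  also have "\<dots> = (\<integral>\<^sup>+v. emeasure (draw_kernel v) A \<partial>distr unif borel (quantile D))"
    by (simp only: distr_quantile_unif)
  also have "\<dots> = (\<integral>\<^sup>+q. f q \<partial>unif)"
    unfolding f_def by (rule nn_integral_distr) measurable
  also have "\<dots> = (\<integral>\<^sup>+q. g q \<partial>unif)"
  proof -
    have off: "(\<integral>\<^sup>+q. f q * indicator (- quantile D -` atoms) q \<partial>unif)
        = (\<integral>\<^sup>+q. g q * indicator (- quantile D -` atoms) q \<partial>unif)"
    proof (rule nn_integral_cong_AE)
      show "AE q in unif. f q * indicator (- quantile D -` atoms) q = g q * indicator (- quantile D -` atoms) q"
        using AE_unif
      proof eventually_elim
        case (elim q)
        then have "q \<in> levels (quantile D q)" by (simp add: levels_def)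
        then show ?case
          using draw_kernel_off_atoms[OF _ _ A, of "quantile D q" q]
          by (cases "quantile D q \<in> atoms") (auto simp: f_def g_def indicator_def)
      qed
    qed
    show ?thesis
      unfolding split[of f, simplified] split[of g, simplified] off
      unfolding f_def g_def nn_integral_draw_atom[OF A] ..
  qed
  also have "\<dots> = (\<integral>\<^sup>+q. indicator ((\<lambda>q. (quantile D q, q)) -` A) q \<partial>unif)"
    unfolding g_def by (intro nn_integral_cong) (auto simp: indicator_def)
  also have "\<dots> = emeasure unif ((\<lambda>q. (quantile D q, q)) -` A)"
    by (rule nn_integral_indicator) (use measurable_sets[OF pair A] in simp)
  also have "\<dots> = emeasure (distr unif (borel \<Otimes>\<^sub>M borel) (\<lambda>q. (quantile D q, q))) A"
    by (subst emeasure_distr) auto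
  finally show "emeasure (ability_draw_law D) A = emeasure (distr unif (borel \<Otimes>\<^sub>M borel) (\<lambda>q. (quantile D q, q))) A" .
qed

end

section \<open>Best subsets of bounded size\<close>

text \<open>
  With \<open>f\<close> the abilities, this is the hindsight value of having budget \<open>b\<close> for the periods in \<open>S\<close>.
\<close>

definition topsum :: "'i set \<Rightarrow> nat \<Rightarrow> ('i \<Rightarrow> real) \<Rightarrow> real" where
  "topsum S b f = Max {sum f A | A. A \<subseteq> S \<and> card A \<le> b}"

lemma finite_topsum_set: "finite S \<Longrightarrow> finite {sum f A | A. A \<subseteq> S \<and> card A \<le> b}"
  by (rule finite_subset[of _ "sum f ` Pow S"]) auto

lemma topsum_ge: "finite S \<Longrightarrow> A \<subseteq> S \<Longrightarrow> card A \<le> b \<Longrightarrow> sum f A \<le> topsum S b f"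
  unfolding topsum_def by (rule Max_ge[OF finite_topsum_set]) auto

lemma topsum_attained:
  assumes "finite S" obtains A where "A \<subseteq> S" "card A \<le> b" "topsum S b f = sum f A"
proof -
  have "topsum S b f \<in> {sum f A | A. A \<subseteq> S \<and> card A \<le> b}"
    unfolding topsum_def
    by (rule Max_in[OF finite_topsum_set[OF assms]]) (auto intro!: exI[of _ "{}"])
  then show ?thesis using that by blast
qed

text \<open>
  Spending one unit of budget on \<open>t\<close> costs at most \<open>c\<close>: if the best set omits \<open>t\<close> and exhausts the
  budget, then trading one of its members for \<open>t\<close> loses at most \<open>c\<close>.
\<close>

lemma topsum_accept:
  assumes S: "finite S" "t \<notin> S" and b: "b > 0" and pos: "0 \<le> f t + c" and c: "0 \<le> c"
    and ex: "\<And>A. A \<subseteq> S \<Longrightarrow> card A = b \<Longrightarrow> \<exists>s\<in>A. f s \<le> f t + c"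
  shows "topsum (insert t S) b f \<le> f t + c + topsum S (b - 1) f"
proof -
  obtain A where A: "A \<subseteq> insert t S" "card A \<le> b" "topsum (insert t S) b f = sum f A"
    using topsum_attained[of "insert t S" b f] S by blast
  have fA: "finite A" using A(1) S finite_subset by blast
  show ?thesis
  proof (cases "t \<in> A")
    case True
    have "sum f (A - {t}) \<le> topsum S (b - 1) f"
      using A True fA by (intro topsum_ge S) auto
    then show ?thesis using A(3) c sum.remove[OF fA True, of f] by simp
  next
    case False
    then have AS: "A \<subseteq> S" using A by blast
    show ?thesis
    proof (cases "card A < b")
      case True
      then have "sum f A \<le> topsum S (b - 1) f" using AS by (intro topsum_ge S) auto
      then show ?thesis using A(3) pos by simp
    next
      case F: False
      then obtain s where s: "s \<in> A" "f s \<le> f t + c" using ex[OF AS] A by fastforce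
      have "sum f (A - {s}) \<le> topsum S (b - 1) f"
        using AS A s fA by (intro topsum_ge S) auto
      then show ?thesis using A(3) s(2) sum.remove[OF fA s(1), of f] by simp
    qed
  qed
qed

text \<open>
  Skipping \<open>t\<close> costs at most \<open>c\<close>: if the best set contains \<open>t\<close>, then an unused member of \<open>S\<close> can
  take its place.
\<close>

lemma topsum_reject:
  assumes S: "finite S" "t \<notin> S" and c: "0 \<le> c"
    and ex: "\<And>A. A \<subseteq> S \<Longrightarrow> card A < b \<Longrightarrow> \<exists>s\<in>S - A. f t \<le> f s + c"
  shows "topsum (insert t S) b f \<le> c + topsum S b f"
proof -
  obtain A where A: "A \<subseteq> insert t S" "card A \<le> b" "topsum (insert t S) b f = sum f A"
    using topsum_attained[of "insert t S" b f] S by blast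
  have fA: "finite A" using A(1) S finite_subset by blast
  show ?thesis
  proof (cases "t \<in> A")
    case True
    have "card (A - {t}) < card A" by (rule card_Diff1_less[OF fA True])
    then obtain s where s: "s \<in> S" "s \<notin> A - {t}" "f t \<le> f s + c"
      using ex[of "A - {t}"] A by fastforce
    have "sum f (insert s (A - {t})) \<le> topsum S b f"
      using s(1) A \<open>card (A - {t}) < card A\<close> fA s(2) by (intro topsum_ge S) auto
    then show ?thesis using A(3) s fA sum.remove[OF fA True, of f] by simp
  next
    case False
    then have "sum f A \<le> topsum S b f" using A by (intro topsum_ge S) auto
    then show ?thesis using A(3) c by simp
  qed
qed

lemma topsum_insert_le:
  assumes S: "finite S" "t \<notin> S" and f: "f t \<le> 1"
  shows "topsum (insert t S) b f \<le> 1 + topsum S b f"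
proof -
  obtain A where A: "A \<subseteq> insert t S" "card A \<le> b" "topsum (insert t S) b f = sum f A"
    using topsum_attained[of "insert t S" b f] S by blast
  have fA: "finite A" using A(1) S finite_subset by blast
  have "card (A - {t}) \<le> b" using A(2) fA by (meson card_Diff1_le le_trans)
  then have "sum f (A - {t}) \<le> topsum S b f" using A by (intro topsum_ge S) auto
  moreover have "sum f A \<le> 1 + sum f (A - {t})"
    using f fA by (cases "t \<in> A") (auto simp: sum.remove)
  ultimately show ?thesis using A(3) by simp
qed

lemma topsum_nonneg: "finite S \<Longrightarrow> 0 \<le> topsum S b f"
  using topsum_ge[of S "{}" b f] by simp

lemma topsum_le_card:
  assumes "finite S" "\<And>s. s \<in> S \<Longrightarrow> f s \<le> 1" shows "topsum S b f \<le> card S"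
proof -
  obtain A where A: "A \<subseteq> S" "card A \<le> b" "topsum S b f = sum f A"
    using topsum_attained[OF assms(1)] by blast
  have "sum f A \<le> of_nat (card A) * 1" using A assms by (intro sum_bounded_above) auto
  also have "\<dots> \<le> card S" using A card_mono[OF assms(1)] by simp
  finally show ?thesis using A by simp
qed

lemma offline_opt_eq: "offline_opt T B \<theta> = topsum {1..T} B \<theta>"
proof -
  have "{(\<Sum>t=1..T. \<theta> t * a t) | a. a \<in> {1..T} \<rightarrow>\<^sub>E {0, 1} \<and> (\<Sum>t=1..T. a t) \<le> real B}
      = {sum \<theta> A | A. A \<subseteq> {1..T} \<and> card A \<le> B}" (is "?L = ?R")
  proof (intro equalityI subsetI)
    fix y assume "y \<in> ?L"
    then obtain a where a: "y = (\<Sum>t=1..T. \<theta> t * a t)" "a \<in> {1..T} \<rightarrow>\<^sub>E {0, 1}" "(\<Sum>t=1..T. a t) \<le> real B"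
      by blast
    define A where "A = {t \<in> {1..T}. a t = 1}"
    have a01: "a t = indicator A t" if "t \<in> {1..T}" for t
      using PiE_mem[OF a(2) that] that by (auto simp: A_def indicator_def)
    have A: "A \<subseteq> {1..T}" by (auto simp: A_def)
    have "y = (\<Sum>t=1..T. \<theta> t * indicator A t)" unfolding a(1) by (rule sum.cong) (use a01 in auto)
    also have "\<dots> = sum \<theta> A" using A by (subst sum_mult_indicator) (auto intro!: sum.cong)
    finally have "y = sum \<theta> A" .
    moreover have "(\<Sum>t=1..T. a t) = real (card A)"
    proof -
      have "(\<Sum>t=1..T. a t) = (\<Sum>t=1..T. indicator A t)" by (rule sum.cong) (use a01 in auto)
      also have "\<dots> = real (card ({1..T} \<inter> A))" by (simp add: indicator_def of_bool_def sum.If_cases Int_def)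
      finally show ?thesis using A by (simp add: Int_absorb1)
    qed
    ultimately show "y \<in> ?R" using a(3) A by auto
  next
    fix y assume "y \<in> ?R"
    then obtain A where A: "y = sum \<theta> A" "A \<subseteq> {1..T}" "card A \<le> B" by blast
    define a :: "nat \<Rightarrow> real" where "a = restrict (indicator A) {1..T}"
    have "a \<in> {1..T} \<rightarrow>\<^sub>E {0, 1}" by (auto simp: a_def indicator_def)
    moreover have "(\<Sum>t=1..T. a t) = real (card ({1..T} \<inter> A))"
    proof -
      have "(\<Sum>t=1..T. a t) = (\<Sum>t=1..T. indicator A t)" by (rule sum.cong) (auto simp: a_def)
      then show ?thesis by (simp add: indicator_def of_bool_def sum.If_cases Int_def)
    qed
    moreover have "(\<Sum>t=1..T. \<theta> t * a t) = sum \<theta> A"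
    proof -
      have "(\<Sum>t=1..T. \<theta> t * a t) = (\<Sum>t=1..T. \<theta> t * indicator A t)" by (rule sum.cong) (auto simp: a_def)
      also have "\<dots> = sum \<theta> A" using A by (subst sum_mult_indicator) (auto intro!: sum.cong)
      finally show ?thesis .
    qed
    ultimately show "y \<in> ?L" using A by (auto simp: Int_absorb1 intro!: exI[of _ a])
  qed
  then show ?thesis unfolding offline_opt_def topsum_def by simp
qed

section \<open>Clusters\<close>

text \<open>
  The probability of misleading future levels when \<open>N\<close> periods remain.  In the last period there are
  none, so \<open>tail_mass 1\<close> vanishes; this is needed because the regret bound is \<open>0\<close> for \<open>T = 1\<close> and
  \<open>\<epsilon>0 = 1\<close>.
\<close>

definition tail_mass :: "nat \<Rightarrow> real" where
  "tail_mass N = (if 2 \<le> N then 2 / (real N)\<^sup>2 else 0)"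

locale clustered_problem = unit_distribution D for D +
  fixes C0 \<beta> \<epsilon>0 \<delta> :: real and n :: nat and qs :: "nat \<Rightarrow> real" and T :: nat and p :: "nat \<Rightarrow> nat \<Rightarrow> real"
  assumes beta: "0 \<le> \<beta>" and eps: "0 < \<epsilon>0" "\<epsilon>0 \<le> 1" and delta: "0 \<le> \<delta>" "\<delta> \<le> 1"
    and clustered: "clustered_with C0 \<beta> \<epsilon>0 \<delta> D n qs"
    and rule: "CwG_threshold_rule T n qs p"
begin

abbreviation (input) Q :: "real \<Rightarrow> real" where "Q \<equiv> quantile D"

text \<open>
  The absolute value makes the modulus monotone and nonnegative for every sign of \<open>C0\<close>.
\<close>

definition modulus :: "real \<Rightarrow> real" where
  "modulus h = \<bar>C0\<bar> * h powr (1 / (\<beta> + 1)) + \<delta>"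

lemma modulus_nonneg: "0 \<le> modulus h"
  using delta by (simp add: modulus_def)

lemma modulus_mono: "0 \<le> h \<Longrightarrow> h \<le> h' \<Longrightarrow> modulus h \<le> modulus h'"
  unfolding modulus_def using beta by (intro add_right_mono mult_left_mono powr_mono2) auto

lemma qs_0: "qs 0 = 0" and qs_last: "qs (n + 1) = 1"
  and qs_gap: "i \<in> {1..n+1} \<Longrightarrow> \<epsilon>0 \<le> qs i - qs (i - 1)"
  using clustered by (auto simp: clustered_with_def)

lemma qs_separated: "i < j \<Longrightarrow> j \<le> n + 1 \<Longrightarrow> \<epsilon>0 \<le> qs j - qs i"
proof (induction j)
  case (Suc j)
  have "\<epsilon>0 \<le> qs (Suc j) - qs j" using qs_gap[of "Suc j"] Suc by simp
  then show ?case using Suc eps by (cases "i = j") auto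
qed simp

lemma qs_sep: "i \<noteq> j \<Longrightarrow> i \<le> n + 1 \<Longrightarrow> j \<le> n + 1 \<Longrightarrow> \<epsilon>0 \<le> \<bar>qs j - qs i\<bar>"
  using qs_separated[of i j] qs_separated[of j i] eps by (cases "i < j") auto

text \<open>
  Two levels with no gap quantile in \<open>[y, z)\<close> lie in one cluster.  Right-hand endpoints belong to the
  cluster on their left, which is why \<open>z\<close> itself may be a gap quantile but \<open>y\<close> may not.
\<close>

lemma quantile_diff_le:
  assumes y: "0 < y" "y < z" "z \<le> 1" and nogap: "\<And>i. i \<in> {1..n} \<Longrightarrow> \<not> (y \<le> qs i \<and> qs i < z)"
  shows "Q z - Q y \<le> modulus (z - y)"
proof -
  define i where "i = (LEAST i. y \<le> qs i)"
  have "y \<le> qs (n + 1)" using y qs_last by simp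
  then have yi: "y \<le> qs i" and i_le: "i \<le> n + 1"
    unfolding i_def by (rule LeastI, rule Least_le)
  have "i \<noteq> 0" using yi qs_0 y by (cases "i = 0") auto
  then have yi': "qs (i - 1) < y"
    using not_less_Least[of "i - 1" "\<lambda>i. y \<le> qs i"] unfolding i_def[symmetric] by simp
  have zi: "z \<le> qs i"
  proof (cases "i = n + 1")
    case True then show ?thesis using y qs_last by simp
  next
    case False then show ?thesis using nogap[of i] yi i_le \<open>i \<noteq> 0\<close> by force
  qed
  have i: "i \<in> {1..n+1}" using i_le \<open>i \<noteq> 0\<close> by simp
  have all: "\<forall>i\<in>{1..n+1}. \<forall>q\<in>{qs (i - 1)<..qs i}. \<forall>q'\<in>{qs (i - 1)<..qs i}.
        \<bar>Q q - Q q'\<bar> \<le> C0 * \<bar>q - q'\<bar> powr (1 / (\<beta> + 1)) + \<delta>"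
    using clustered unfolding clustered_with_def by blast
  have "\<bar>Q z - Q y\<bar> \<le> C0 * \<bar>z - y\<bar> powr (1 / (\<beta> + 1)) + \<delta>"
    by (rule all[rule_format, OF i]) (use yi yi' zi y in auto)
  also have "\<dots> \<le> modulus (z - y)"
    using y unfolding modulus_def by (intro add_right_mono mult_mono) auto
  finally show ?thesis by simp
qed

text \<open>
  The half-width that decides in \<open>near_gaps\<close> whether a gap quantile is near.
\<close>

definition radius :: "nat \<Rightarrow> real" where
  "radius t = sqrt (2 * ln (real T - real t + 1) / (real T - real t + 1))"

lemma radius_nonneg: "t \<le> T \<Longrightarrow> 0 \<le> radius t"
  unfolding radius_def by simp

lemma near_gaps_alt: "near_gaps T n qs t b = {i \<in> {1..n}. \<bar>p_CE T t b - qs i\<bar> \<le> radius t}"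
  unfolding near_gaps_def radius_def ..

lemma threshold_cases:
  assumes "t \<in> {1..T}"
  obtains (free) "\<And>i. i \<in> {1..n} \<Longrightarrow> radius t < \<bar>p_CE T t b - qs i\<bar>" "p t b = p_CE T t b"
  | (gap) j where "j \<in> {1..n}" "\<bar>p_CE T t b - qs j\<bar> \<le> radius t" "p t b = qs j"
proof (cases "near_gaps T n qs t b = {}")
  case True
  then have "p t b = p_CE T t b"
    using rule assms unfolding CwG_threshold_rule_def by (metis (full_types))
  moreover have "radius t < \<bar>p_CE T t b - qs i\<bar>" if "i \<in> {1..n}" for i
    using True that unfolding near_gaps_alt by force
  ultimately show ?thesis using free by blast
next
  case False
  then obtain j where "is_arg_min (\<lambda>i. \<bar>p_CE T t b - qs i\<bar>) (\<lambda>i. i \<in> near_gaps T n qs t b) j" "p t b = qs j"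
    using rule assms unfolding CwG_threshold_rule_def by (metis (full_types))
  then show ?thesis using gap[of j] unfolding is_arg_min_def near_gaps_alt by blast
qed

lemma threshold_near_CE:
  assumes "t \<in> {1..T}" shows "\<bar>p t b - p_CE T t b\<bar> \<le> radius t"
  using assms by (cases rule: threshold_cases[of t b]) (use radius_nonneg[of t] assms in auto)

text \<open>
  If the threshold is a gap quantile, it is excluded by \<open>y \<notin> qs ` {1..n}\<close>, and every other one is at
  distance at least \<open>\<epsilon>0 > 2 * radius t\<close>.  If it is not, then no gap quantile is within the radius of
  the certainty-equivalent threshold at all.
\<close>

lemma no_gap_above_threshold:
  assumes t: "t \<in> {1..T}" and small: "0 < n \<Longrightarrow> 2 * radius t < \<epsilon>0"
    and y: "p t b \<le> y" "y \<notin> qs ` {1..n}" and z: "z \<le> p_CE T t b + radius t" and i: "i \<in> {1..n}"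
  shows "\<not> (y \<le> qs i \<and> qs i < z)"
proof
  assume *: "y \<le> qs i \<and> qs i < z"
  show False
  proof (cases rule: threshold_cases[OF t, of b, case_names free gap])
    case free then show False using * y z free(1)[OF i] by linarith
  next
    case (gap j)
    have "i \<noteq> j" using * y i gap by auto
    then have "\<epsilon>0 \<le> \<bar>qs j - qs i\<bar>" using qs_sep gap i by simp
    moreover have "2 * radius t < \<epsilon>0" using small i by simp
    ultimately show False using * y z gap by linarith
  qed
qed

lemma no_gap_below_threshold:
  assumes t: "t \<in> {1..T}" and small: "0 < n \<Longrightarrow> 2 * radius t < \<epsilon>0"
    and y: "p_CE T t b - radius t \<le> y" and z: "z < p t b" and i: "i \<in> {1..n}"
  shows "\<not> (y \<le> qs i \<and> qs i < z)"
proof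
  assume *: "y \<le> qs i \<and> qs i < z"
  show False
  proof (cases rule: threshold_cases[OF t, of b, case_names free gap])
    case free then show False using * y z free(1)[OF i] by linarith
  next
    case (gap j)
    have "i \<noteq> j" using * z gap by auto
    then have "\<epsilon>0 \<le> \<bar>qs j - qs i\<bar>" using qs_sep gap i by simp
    moreover have "2 * radius t < \<epsilon>0" using small i by simp
    ultimately show False using * y z gap by linarith
  qed
qed

text \<open>
  The later levels mislead the policy: the \<open>b\<close>-th largest of them is farther than the radius from
  the certainty-equivalent threshold.  For \<open>b = 0\<close> and for \<open>b > T - t\<close> the right decision does not
  depend on the later levels.
\<close>

definition bad :: "nat \<Rightarrow> nat \<Rightarrow> (nat \<Rightarrow> real) \<Rightarrow> bool" where
  "bad t b x \<longleftrightarrow> 0 < b \<and> b \<le> T - t \<and>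
     (b \<le> card {s \<in> {Suc t..T}. p_CE T t b + radius t < x s} \<or>
      card {s \<in> {Suc t..T}. p_CE T t b - radius t \<le> x s} < b)"

definition step_loss :: "nat \<Rightarrow> nat \<Rightarrow> (nat \<Rightarrow> real) \<Rightarrow> real" where
  "step_loss t b x = modulus (2 * radius t) * of_bool (\<bar>x t - p t b\<bar> \<le> 2 * radius t) + of_bool (bad t b x)"

text \<open>
  The loss of one decision.  On a bad path abilities in \<open>[0, 1]\<close> give a loss of at most \<open>1\<close>.
  Otherwise the exchange lemmas apply to a later period \<open>s\<close> whose level lies on the near side of one
  end of the confidence interval around \<open>p_CE T t b\<close>.  The exchange can only gain if \<open>x t\<close> and \<open>x s\<close>
  both lie between the threshold and that end; the two levels are then in one cluster, at distance
  at most \<open>2 * radius t\<close>.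
\<close>

lemma step_loss_bound:
  assumes t: "t \<in> {1..T}" and small: "0 < n \<Longrightarrow> 2 * radius t < \<epsilon>0"
    and x: "\<And>s. s \<in> {1..T} \<Longrightarrow> 0 < x s \<and> x s \<le> 1" "x t \<notin> qs ` {1..n}"
    and f: "\<And>s. s \<in> {1..T} \<Longrightarrow> f s = Q (x s)"
  shows "topsum {t..T} b f \<le>
     (if p t b \<le> x t \<and> 0 < b then f t + topsum {Suc t..T} (b - 1) f else topsum {Suc t..T} b f)
     + step_loss t b x"
proof -
  let ?S = "{Suc t..T}" and ?r = "radius t"
  let ?u = "p_CE T t b + ?r" and ?l = "p_CE T t b - ?r"
  define c where "c = modulus (2 * ?r) * of_bool (\<bar>x t - p t b\<bar> \<le> 2 * ?r)"
  have S: "{t..T} = insert t ?S" "finite ?S" "t \<notin> ?S" using t by auto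
  have f01: "0 \<le> f s" "f s \<le> 1" if "s \<in> {1..T}" for s
    using that x f quantile_nonneg quantile_le_one by auto
  have fmono: "f s \<le> f s'" if "s \<in> {1..T}" "s' \<in> {1..T}" "x s \<le> x s'" for s s'
    using that x f quantile_mono by auto
  have r0: "0 \<le> ?r" using t radius_nonneg by simp
  have near: "\<bar>p t b - p_CE T t b\<bar> \<le> ?r" by (rule threshold_near_CE[OF t])
  have c0: "0 \<le> c" using modulus_nonneg by (simp add: c_def)
  show ?thesis
  proof (cases "bad t b x")
    case True
    have loss: "1 \<le> step_loss t b x" unfolding step_loss_def c_def[symmetric] using True c0 by simp
    show ?thesis
    proof (cases "p t b \<le> x t \<and> 0 < b")
      case acc: True
      have "topsum {t..T} b f \<le> f t + 1 + topsum ?S (b - 1) f"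
        unfolding S(1)
      proof (rule topsum_accept[OF S(2,3)])
        fix A assume A: "A \<subseteq> ?S" "card A = b"
        then obtain s where "s \<in> A" using acc by fastforce
        then show "\<exists>s\<in>A. f s \<le> f t + 1" using f01[of s] f01[of t] A t by (intro bexI[of _ s]) auto
      qed (use acc f01[of t] t in auto)
      then show ?thesis using acc loss by simp
    next
      case False
      have "topsum {t..T} b f \<le> 1 + topsum ?S b f"
        unfolding S(1) by (rule topsum_insert_le[OF S(2,3)]) (use f01 t in auto)
      then show ?thesis using False loss by auto
    qed
  next
    case nbad: False
    have loss: "step_loss t b x = c" unfolding step_loss_def c_def using nbad by simp
    show ?thesis
    proof (cases "p t b \<le> x t \<and> 0 < b")
      case acc: True
      have "topsum {t..T} b f \<le> f t + c + topsum ?S (b - 1) f"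
        unfolding S(1)
      proof (rule topsum_accept[OF S(2,3)])
        fix A assume A: "A \<subseteq> ?S" "card A = b"
        then have "b \<le> T - t" using card_mono[OF S(2) A(1)] by simp
        then have "card {s \<in> ?S. ?u < x s} < b" using nbad acc unfolding bad_def by auto
        then have "\<not> A \<subseteq> {s \<in> ?S. ?u < x s}" using A(2) card_mono[of "{s \<in> ?S. ?u < x s}" A] by auto
        then obtain s where s: "s \<in> A" "x s \<le> ?u" using A(1) by force
        have sT: "s \<in> {1..T}" using s A by auto
        have "f s \<le> f t + c"
        proof (cases "x s \<le> x t")
          case True then show ?thesis using fmono[OF sT t] c0 by simp
        next
          case False
          have "Q (x s) - Q (x t) \<le> modulus (x s - x t)"
            using no_gap_above_threshold[OF t small _ x(2) s(2)] acc False x(1)[OF sT] x(1)[OF t]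
            by (intro quantile_diff_le) auto
          also have "\<dots> \<le> modulus (2 * ?r)" using False near acc s(2) by (intro modulus_mono) auto
          also have "\<dots> = c"
          proof -
            have "\<bar>x t - p t b\<bar> \<le> 2 * ?r" using False near acc s(2) by linarith
            then show ?thesis by (simp add: c_def)
          qed
          finally show ?thesis using f[OF sT] f[OF t] by simp
        qed
        then show "\<exists>s\<in>A. f s \<le> f t + c" using s by blast
      qed (use acc f01[of t] t c0 in auto)
      then show ?thesis using acc loss by simp
    next
      case rej: False
      have "topsum {t..T} b f \<le> c + topsum ?S b f"
        unfolding S(1)
      proof (rule topsum_reject[OF S(2,3) c0])
        fix A assume A: "A \<subseteq> ?S" "card A < b"
        then have lt: "x t < p t b" and b: "0 < b" using rej by auto
        \<comment> \<open>With enough budget for all remaining periods the certainty-equivalent threshold is at most 0,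
          which is too far from every gap quantile, so the policy would have accepted.\<close>
        have "b \<le> T - t"
        proof (rule ccontr)
          assume nb: "\<not> b \<le> T - t"
          then have CE: "p_CE T t b \<le> 0" using t unfolding p_CE_def by (simp add: field_simps)
          show False
          proof (cases rule: threshold_cases[OF t, of b, case_names free gap])
            case free then show False using CE lt x(1)[OF t] by simp
          next
            case (gap j)
            have "\<epsilon>0 \<le> qs j" using qs_separated[of 0 j] qs_0 gap by simp
            then show False using gap CE small r0 by auto
          qed
        qed
        then have "b \<le> card {s \<in> ?S. ?l \<le> x s}" using nbad b unfolding bad_def by auto
        then have "\<not> {s \<in> ?S. ?l \<le> x s} \<subseteq> A"
          using A card_mono[of A "{s \<in> ?S. ?l \<le> x s}"] finite_subset[OF A(1)] by auto
        then obtain s where s: "s \<in> ?S - A" "?l \<le> x s" by blast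
        have sT: "s \<in> {1..T}" using s by auto
        have "f t \<le> f s + c"
        proof (cases "x t \<le> x s")
          case True then show ?thesis using fmono[OF t sT] c0 by simp
        next
          case False
          have "Q (x t) - Q (x s) \<le> modulus (x t - x s)"
            using no_gap_below_threshold[OF t small s(2) lt] False x(1)[OF sT] x(1)[OF t]
            by (intro quantile_diff_le) auto
          also have "\<dots> \<le> modulus (2 * ?r)" using False near lt s(2) by (intro modulus_mono) auto
          also have "\<dots> = c"
          proof -
            have "\<bar>x t - p t b\<bar> \<le> 2 * ?r" using False near lt s(2) by linarith
            then show ?thesis by (simp add: c_def)
          qed
          finally show ?thesis using f[OF sT] f[OF t] by simp
        qed
        then show "\<exists>s\<in>?S - A. f t \<le> f s + c" using s by blast
      qed
      then show ?thesis using rej loss by auto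
    qed
  qed
qed

section \<open>The policy along a sample path\<close>

abbreviation t0 :: nat where "t0 \<equiv> phase1_length T \<epsilon>0"

lemma phase1_length_le: "t0 \<le> T"
proof -
  have "0 \<le> 64 * ln (1 / \<epsilon>0) / \<epsilon>0\<^sup>2" using eps by simp
  then have "0 \<le> \<lfloor>64 * ln (1 / \<epsilon>0) / \<epsilon>0\<^sup>2\<rfloor>" by simp
  then show ?thesis unfolding phase1_length_def by linarith
qed

lemma phase2_length_le: "real (T - t0) \<le> 64 * ln (1 / \<epsilon>0) / \<epsilon>0\<^sup>2"
proof -
  let ?M = "64 * ln (1 / \<epsilon>0) / \<epsilon>0\<^sup>2"
  have "0 \<le> ?M" using eps by simp
  then have "int (T - t0) \<le> \<lfloor>?M\<rfloor>" unfolding phase1_length_def by linarith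
  then show ?thesis by linarith
qed

text \<open>
  The length of the second phase is chosen for this estimate: during the first phase gap quantiles are
  farther apart than the uncertainty about the right threshold.  With \<open>M = 64 L / \<epsilon>0\<^sup>2\<close> and
  \<open>L = ln (1 / \<epsilon>0)\<close>, the claim amounts to \<open>8 ln N < \<epsilon>0\<^sup>2 N\<close> for \<open>N > M\<close>, and the tangent of \<open>ln\<close> at \<open>M\<close>
  reduces it to \<open>ln M \<le> 8 L\<close>.
\<close>

lemma phase1_radius:
  assumes t: "t \<in> {1..t0}" and n: "0 < n"
  shows "2 * radius t < \<epsilon>0"
proof -
  define L where "L = ln (1 / \<epsilon>0)"
  define M where "M = 64 * L / \<epsilon>0\<^sup>2"
  define N where "N = real T - real t + 1"
  \<comment> \<open>A gap splits the unit interval into clusters of mass at least \<open>\<epsilon>0\<close>, so \<open>\<epsilon>0 \<le> 1/2\<close> and \<open>L \<ge> ln 2\<close>.\<close>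
  have "\<epsilon>0 \<le> qs 1 - qs 0" "\<epsilon>0 \<le> qs (n + 1) - qs 1"
    using qs_separated[of 0 1] qs_separated[of 1 "n + 1"] n by auto
  then have half: "\<epsilon>0 \<le> 1 / 2" using qs_0 qs_last by simp
  then have L2: "ln 2 \<le> L" unfolding L_def using eps by (intro ln_mono) (auto simp: field_simps)
  have Lpos: "0 < L" using L2 ln_gt_zero[of "2::real"] by linarith
  have M0: "0 < M" unfolding M_def using Lpos eps by simp
  have "int t \<le> int T - \<lfloor>M\<rfloor>" using t unfolding phase1_length_def M_def L_def by auto
  then have NM: "M < N" unfolding N_def by linarith
  have "ln M = 6 * ln 2 + ln L + 2 * L"
  proof -
    have "ln (64::real) = 6 * ln 2" using ln_realpow[of "2::real" 6] by simp
    moreover have "ln M = ln 64 + ln L + ln (1 / \<epsilon>0\<^sup>2)"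
      unfolding M_def using Lpos eps ln_mult[of "64 * L" "1 / \<epsilon>0\<^sup>2"] ln_mult[of 64 L] by simp
    moreover have "ln (1 / \<epsilon>0\<^sup>2) = 2 * L"
      unfolding L_def using eps ln_realpow[of "1 / \<epsilon>0" 2] by (simp add: power_one_over)
    ultimately show ?thesis by simp
  qed
  moreover have "ln L \<le> L - 1" using ln_le_minus_one[OF Lpos] .
  moreover have "ln 2 \<le> (1::real)" using ln_le_minus_one[of "2::real"] by simp
  ultimately have lnM: "ln M \<le> 8 * L" using L2 by linarith
  have M1: "ln M > 1"
  proof -
    have "64 * ln 2 \<le> M"
    proof -
      have "\<epsilon>0\<^sup>2 \<le> 1" using eps by (simp add: power_le_one)
      then have "64 * L * 1 \<le> 64 * L * (1 / \<epsilon>0\<^sup>2)" using Lpos eps by (intro mult_left_mono) auto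
      then show ?thesis unfolding M_def using L2 by simp
    qed
    moreover have "(1/2::real) \<le> ln 2" using ln2_ge_two_thirds by simp
    ultimately have "32 \<le> M" by linarith
    then have "exp 1 < M" using exp_le by linarith
    then have "ln (exp 1) < ln M" by (subst ln_less_cancel_iff) (use M0 in auto)
    then show ?thesis by simp
  qed
  have "ln (N / M) \<le> N / M - 1" using ln_le_minus_one[of "N / M"] M0 NM by simp
  then have lnN: "ln N \<le> N / M - 1 + ln M" using M0 NM ln_div[of N M] by simp
  have "8 * ln N < \<epsilon>0\<^sup>2 * N"
  proof -
    have "(ln M - 1) * 1 < (ln M - 1) * (N / M)"
      by (rule mult_strict_left_mono) (use M1 NM M0 in auto)
    then have "ln N < ln M * (N / M)" using lnN by (simp add: algebra_simps)
    also have "\<dots> \<le> 8 * L * (N / M)" using lnM NM M0 by (intro mult_right_mono) auto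
    also have "\<dots> = \<epsilon>0\<^sup>2 * N / 8" unfolding M_def using Lpos eps by (simp add: field_simps)
    finally show ?thesis by simp
  qed
  then have "2 * ln N / N < (\<epsilon>0 / 2)\<^sup>2" using NM M0 by (simp add: field_simps power2_eq_square)
  then have "sqrt (2 * ln N / N) < sqrt ((\<epsilon>0 / 2)\<^sup>2)" by (rule real_sqrt_less_mono)
  then have "radius t < \<epsilon>0 / 2" using eps unfolding radius_def N_def by simp
  then show ?thesis by simp
qed

definition phase2_level :: "nat \<Rightarrow> real" where
  "phase2_level b = p_CE T (t0 + 1) b"

definition exceedances :: "nat \<Rightarrow> (nat \<Rightarrow> real) \<Rightarrow> nat" where
  "exceedances b x = card {s \<in> {Suc t0..T}. phase2_level b \<le> x s}"

text \<open>
  A budget that covers all remaining periods is spent on every candidate, without loss.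
\<close>

definition phase2_loss :: "nat \<Rightarrow> (nat \<Rightarrow> real) \<Rightarrow> real" where
  "phase2_loss b x = (if b < T - t0 then \<bar>real (exceedances b x) - real b\<bar> else 0)"

lemma budget_Suc:
  "1 \<le> t \<Longrightarrow> CwG_budget T B \<epsilon>0 p x (Suc t) =
     (if CwG_accepts T B \<epsilon>0 p x t then CwG_budget T B \<epsilon>0 p x t - 1 else CwG_budget T B \<epsilon>0 p x t)"
  by (cases t) (auto simp: CwG_accepts_def simp del: CwG_threshold.simps)

lemma budget_le: "CwG_budget T B \<epsilon>0 p x t \<le> B"
proof (induction t)
  case (Suc t)
  then show ?case by (cases "t = 0") (auto simp: budget_Suc)
qed simp

text \<open>
  The telescoping of hindsight values along the budget path of the policy.
\<close>

lemma phase1_path: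
  assumes x: "\<And>s. s \<in> {1..T} \<Longrightarrow> 0 < x s \<and> x s \<le> 1" "\<And>s. s \<in> {1..T} \<Longrightarrow> x s \<notin> qs ` {1..n}"
    and f: "\<And>s. s \<in> {1..T} \<Longrightarrow> f s = Q (x s)"
  shows "k \<le> t0 \<Longrightarrow> topsum {1..T} B f \<le> (\<Sum>t=1..k. f t * of_bool (CwG_accepts T B \<epsilon>0 p x t))
     + topsum {Suc k..T} (CwG_budget T B \<epsilon>0 p x (Suc k)) f
     + (\<Sum>t=1..k. step_loss t (CwG_budget T B \<epsilon>0 p x t) x)"
proof (induction k)
  case (Suc k)
  let ?t = "Suc k" and ?b = "CwG_budget T B \<epsilon>0 p x (Suc k)"
  have t: "?t \<in> {1..T}" using Suc phase1_length_le by simp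
  have small: "0 < n \<Longrightarrow> 2 * radius ?t < \<epsilon>0" by (rule phase1_radius) (use Suc in auto)
  have acc: "CwG_accepts T B \<epsilon>0 p x ?t \<longleftrightarrow> p ?t ?b \<le> x ?t \<and> 0 < ?b"
    using Suc.prems by (simp add: CwG_accepts_def)
  have "topsum {?t..T} ?b f \<le>
     (if p ?t ?b \<le> x ?t \<and> 0 < ?b then f ?t + topsum {Suc ?t..T} (?b - 1) f else topsum {Suc ?t..T} ?b f)
     + step_loss ?t ?b x"
    using x(2)[OF t] by (intro step_loss_bound[OF t small x(1) _ f])
  also have "\<dots> = f ?t * of_bool (CwG_accepts T B \<epsilon>0 p x ?t)
      + topsum {Suc ?t..T} (CwG_budget T B \<epsilon>0 p x (Suc ?t)) f + step_loss ?t ?b x"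
    using budget_Suc[of ?t B x] acc by (auto simp del: CwG_budget.simps CwG_threshold.simps)
  finally show ?case using Suc by (simp del: CwG_budget.simps)
qed simp

text \<open>
  With a fixed threshold the policy accepts the first \<open>b\<close> candidates above it.  The budget equation
  uses truncated subtraction.
\<close>

lemma phase2_dynamics:
  fixes x :: "nat \<Rightarrow> real" and B :: nat
  defines "b \<equiv> CwG_budget T B \<epsilon>0 p x (Suc t0)"
  shows "CwG_budget T B \<epsilon>0 p x (Suc (t0 + j)) = b - card {s \<in> {Suc t0..t0 + j}. phase2_level b \<le> x s}
    \<and> {s \<in> {Suc t0..t0 + j}. CwG_accepts T B \<epsilon>0 p x s} \<subseteq> {s \<in> {Suc t0..t0 + j}. phase2_level b \<le> x s}
    \<and> card {s \<in> {Suc t0..t0 + j}. CwG_accepts T B \<epsilon>0 p x s} = min (card {s \<in> {Suc t0..t0 + j}. phase2_level b \<le> x s}) b"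
proof (induction j)
  case 0
  then show ?case by (simp add: b_def)
next
  case (Suc j)
  let ?t = "Suc (t0 + j)"
  let ?H = "\<lambda>j. {s \<in> {Suc t0..t0 + j}. phase2_level b \<le> x s}"
  let ?A = "\<lambda>j. {s \<in> {Suc t0..t0 + j}. CwG_accepts T B \<epsilon>0 p x s}"
  have acc: "CwG_accepts T B \<epsilon>0 p x ?t \<longleftrightarrow> phase2_level b \<le> x ?t \<and> 0 < CwG_budget T B \<epsilon>0 p x ?t"
    by (simp add: CwG_accepts_def phase2_level_def b_def)
  have H: "?H (Suc j) = (if phase2_level b \<le> x ?t then insert ?t (?H j) else ?H j)" by (auto simp: le_Suc_eq)
  have A: "?A (Suc j) = (if CwG_accepts T B \<epsilon>0 p x ?t then insert ?t (?A j) else ?A j)" by (auto simp: le_Suc_eq)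
  have cH: "card (?H (Suc j)) = card (?H j) + of_bool (phase2_level b \<le> x ?t)"
    unfolding H by (simp add: card_insert_if)
  have cA: "card (?A (Suc j)) = card (?A j) + of_bool (CwG_accepts T B \<epsilon>0 p x ?t)"
    unfolding A by (simp add: card_insert_if)
  have bud: "CwG_budget T B \<epsilon>0 p x (Suc ?t) = CwG_budget T B \<epsilon>0 p x ?t - of_bool (CwG_accepts T B \<epsilon>0 p x ?t)"
    by (subst budget_Suc) auto
  have sub: "?A (Suc j) \<subseteq> ?H (Suc j)" unfolding H A using Suc acc by auto
  show ?case
    unfolding add_Suc_right bud
    using sub cH cA Suc acc by (auto simp: min_def simp del: CwG_budget.simps)
qed

text \<open>
  With \<open>v\<close> the ability at the threshold, subtracting \<open>v\<close> from every ability makes the summands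
  nonnegative above the threshold and nonpositive below it.  Hindsight therefore gains at most the
  excess of the candidates above the threshold that came after the budget was spent, plus \<open>v\<close> for
  each unit of budget left over.  Only one of the two numbers is nonzero, and each such unit is worth
  at most \<open>1\<close>.
\<close>

lemma phase2_path:
  fixes x :: "nat \<Rightarrow> real" and B :: nat
  defines "b \<equiv> CwG_budget T B \<epsilon>0 p x (Suc t0)"
  assumes x: "\<And>s. s \<in> {1..T} \<Longrightarrow> 0 < x s \<and> x s \<le> 1"
    and f: "\<And>s. s \<in> {1..T} \<Longrightarrow> f s = Q (x s)"
  shows "topsum {Suc t0..T} b f
    \<le> (\<Sum>t=Suc t0..T. f t * of_bool (CwG_accepts T B \<epsilon>0 p x t)) + phase2_loss b x"
proof -
  let ?S = "{Suc t0..T}"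
  define H where "H = {s \<in> ?S. phase2_level b \<le> x s}"
  define Acc where "Acc = {s \<in> ?S. CwG_accepts T B \<epsilon>0 p x s}"
  have Acc: "Acc \<subseteq> H" "card Acc = min (card H) b"
    using phase2_dynamics[of B x "T - t0"] phase1_length_le unfolding H_def Acc_def b_def by auto
  have fin: "finite H" "finite Acc" "H \<subseteq> ?S" "Acc \<subseteq> ?S" unfolding H_def Acc_def by auto
  have f01: "0 \<le> f s" "f s \<le> 1" if "s \<in> ?S" for s
    using that x f quantile_nonneg quantile_le_one by auto
  have reward: "(\<Sum>t=Suc t0..T. f t * of_bool (CwG_accepts T B \<epsilon>0 p x t)) = sum f Acc"
    unfolding Acc_def by (auto simp: sum.inter_filter intro!: sum.cong)
  obtain A where A: "A \<subseteq> ?S" "card A \<le> b" "topsum ?S b f = sum f A"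
    using topsum_attained[of ?S] by blast
  have fA: "finite A" using A(1) finite_subset by blast
  show ?thesis
  proof (cases "b < T - t0")
    case False
    have "H = ?S"
    proof -
      have "phase2_level b \<le> x s" if "s \<in> ?S" for s
      proof -
        have "phase2_level b \<le> 0"
          using False that unfolding phase2_level_def p_CE_def by (auto simp: field_simps)
        also have "0 \<le> x s" using x[of s] that by auto
        finally show ?thesis .
      qed
      then show ?thesis unfolding H_def by blast
    qed
    then have "card Acc = card ?S" using Acc(2) False by simp
    then have "Acc = ?S" using fin(4) card_subset_eq[of ?S Acc] by simp
    moreover have "sum f A \<le> sum f ?S" using A(1) f01 by (intro sum_mono2) auto
    ultimately show ?thesis unfolding reward A(3) phase2_loss_def using False by simp
  next
    case True
    define h where "h = phase2_level b"
    have h: "0 < h" "h \<le> 1"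
      using True unfolding h_def phase2_level_def p_CE_def by (auto simp: field_simps of_nat_diff)
    define v where "v = Q h"
    have v: "0 \<le> v" "v \<le> 1" using h quantile_nonneg quantile_le_one by (auto simp: v_def)
    have above: "v \<le> f s" if "s \<in> H" for s
      using that x f quantile_mono[of h "x s"] by (auto simp: H_def h_def v_def)
    have below: "f s \<le> v" if "s \<in> ?S" "s \<notin> H" for s
      using that x f quantile_mono[of "x s" h] h by (auto simp: H_def h_def v_def)
    have "sum f A = (\<Sum>s\<in>A. f s - v) + card A * v" by (simp add: sum_subtractf)
    also have "(\<Sum>s\<in>A. f s - v) \<le> (\<Sum>s\<in>A \<inter> H. f s - v)"
    proof -
      have "(\<Sum>s\<in>A. f s - v) = (\<Sum>s\<in>A \<inter> H. f s - v) + (\<Sum>s\<in>A - H. f s - v)"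
        by (rule sum.Int_Diff[OF fA])
      moreover have "(\<Sum>s\<in>A - H. f s - v) \<le> 0" using A(1) below by (intro sum_nonpos) auto
      ultimately show ?thesis by simp
    qed
    also have "\<dots> \<le> (\<Sum>s\<in>H. f s - v)" using fin above by (intro sum_mono2) auto
    also have "\<dots> = (\<Sum>s\<in>Acc. f s - v) + (\<Sum>s\<in>H - Acc. f s - v)"
      using sum.subset_diff[OF Acc(1) fin(1), of "\<lambda>s. f s - v"] by simp
    also have "(\<Sum>s\<in>H - Acc. f s - v) \<le> of_nat (card (H - Acc)) * 1"
    proof (rule sum_bounded_above)
      fix s assume "s \<in> H - Acc"
      then have "f s \<le> 1" using f01 fin(3) by blast
      then show "f s - v \<le> 1" using v by simp
    qed
    also have "card A * v \<le> real b * v" using A(2) v by (intro mult_right_mono) auto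
    finally have "sum f A \<le> (\<Sum>s\<in>Acc. f s - v) + real (card (H - Acc)) + real b * v" by simp
    also have "(\<Sum>s\<in>Acc. f s - v) = sum f Acc - card Acc * v" by (simp add: sum_subtractf)
    also have "real (card (H - Acc)) = real (card H) - real (card Acc)"
      using card_Diff_subset[OF fin(2) Acc(1)] card_mono[OF fin(1) Acc(1)] by (simp add: of_nat_diff)
    finally have "sum f A \<le> sum f Acc + (real (card H) - card Acc) + (real b - card Acc) * v"
      by (simp add: algebra_simps)
    moreover have "(real b - card Acc) * v \<le> (real b - card Acc) * 1" using Acc(2) v by (intro mult_left_mono) auto
    moreover have "real (card H) - card Acc + (real b - card Acc) * 1 = \<bar>real (card H) - real b\<bar>"
      using Acc(2) by (auto simp: min_def)
    ultimately have "sum f A \<le> sum f Acc + \<bar>real (card H) - real b\<bar>" by linarith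
    then show ?thesis
      unfolding reward A(3) phase2_loss_def exceedances_def H_def[symmetric] using True by simp
  qed
qed

text \<open>
  The pathwise regret bound.  Levels equal to a gap quantile are excluded because an accepted level
  sitting exactly on the threshold would belong to the cluster below it.
\<close>

theorem regret_path:
  assumes x: "\<And>s. s \<in> {1..T} \<Longrightarrow> 0 < x s \<and> x s \<le> 1" "\<And>s. s \<in> {1..T} \<Longrightarrow> x s \<notin> qs ` {1..n}"
    and f: "\<And>s. s \<in> {1..T} \<Longrightarrow> f s = Q (x s)"
  shows "offline_opt T B f - (\<Sum>t=1..T. f t * of_bool (CwG_accepts T B \<epsilon>0 p x t))
    \<le> (\<Sum>t=1..t0. step_loss t (CwG_budget T B \<epsilon>0 p x t) x)
       + phase2_loss (CwG_budget T B \<epsilon>0 p x (Suc t0)) x"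
proof -
  have "{1..T} = {1..t0} \<union> {Suc t0..T}" using phase1_length_le by auto
  then have "(\<Sum>t=1..T. f t * of_bool (CwG_accepts T B \<epsilon>0 p x t)) =
     (\<Sum>t=1..t0. f t * of_bool (CwG_accepts T B \<epsilon>0 p x t))
     + (\<Sum>t=Suc t0..T. f t * of_bool (CwG_accepts T B \<epsilon>0 p x t))"
    by (subst sum.union_disjoint[symmetric]) auto
  then show ?thesis
    unfolding offline_opt_eq
    using phase1_path[where f=f and x=x and k=t0 and B=B] phase2_path[where f=f and x=x and B=B] x f by simp
qed

end

section \<open>Independent uniform draws\<close>

lemma card_filter_eq_sum: "finite S \<Longrightarrow> real (card {s \<in> S. P s}) = (\<Sum>s\<in>S. of_bool (P s))"
  by (simp add: of_bool_def sum.If_cases Int_def)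

lemma unif_interval_le: "0 \<le> h \<Longrightarrow> measure unif {c - h..c + h} \<le> 2 * h"
proof -
  assume h: "0 \<le> h"
  have "measure unif {c - h..c + h} = measure lborel ({0<..<1} \<inter> {c - h..c + h})" by (rule measure_unif) simp
  also have "\<dots> \<le> measure lborel {c - h..c + h}"
    by (rule measure_mono_fmeasurable) (auto intro: fmeasurable_compact)
  finally show ?thesis using h by simp
qed

lemma unif_greaterThan: "0 \<le> c \<Longrightarrow> c \<le> 1 \<Longrightarrow> measure unif {c<..} = 1 - c"
proof -
  interpret U: prob_space unif by (rule prob_space_unif)
  assume c: "0 \<le> c" "c \<le> 1"
  have "{c<..} = space unif - {..c}" by auto
  then show ?thesis using U.prob_compl[of "{..c}"] unif_atMost[OF c] by simp
qed

lemma unif_atLeast: "0 \<le> c \<Longrightarrow> c \<le> 1 \<Longrightarrow> measure unif {c..} = 1 - c"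
proof -
  interpret U: prob_space unif by (rule prob_space_unif)
  assume c: "0 \<le> c" "c \<le> 1"
  have "measure unif {c} \<le> 0" using unif_interval_le[of 0 c] by simp
  then have "measure unif {c} = 0" using measure_nonneg[of unif "{c}"] by linarith
  moreover have eq: "{c..} = {c} \<union> {c<..}" by auto
  have "measure unif {c..} = measure unif {c} + measure unif {c<..}"
    unfolding eq by (rule U.finite_measure_Union) auto
  ultimately show ?thesis using unif_greaterThan[OF c] by simp
qed

locale uniform_sample = prob_space M for M :: "'w measure" +
  fixes X :: "nat \<Rightarrow> 'w \<Rightarrow> real" and I :: "nat set"
  assumes indep: "indep_vars (\<lambda>_. borel) X I"
    and uniform: "t \<in> I \<Longrightarrow> distr M borel (X t) = unif"
    and finite_I: "finite I"
begin

lemma X_measurable [measurable]: "t \<in> I \<Longrightarrow> X t \<in> borel_measurable M"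
  using indep by (simp add: indep_vars_def)

lemma prob_X: "t \<in> I \<Longrightarrow> E \<in> sets borel \<Longrightarrow> prob {\<omega> \<in> space M. X t \<omega> \<in> E} = measure unif E"
proof -
  assume t: "t \<in> I" and E: "E \<in> sets borel"
  have "measure unif E = measure (distr M borel (X t)) E" using uniform[OF t] by simp
  also have "\<dots> = prob (X t -` E \<inter> space M)" by (rule measure_distr) (use t E in auto)
  also have "X t -` E \<inter> space M = {\<omega> \<in> space M. X t \<omega> \<in> E}" by auto
  finally show ?thesis by simp
qed

lemma AE_X: "AE \<omega> in M. \<forall>s\<in>I. 0 < X s \<omega> \<and> X s \<omega> < 1"
proof (rule AE_finite_allI[OF finite_I])
  fix s assume s: "s \<in> I"
  have "AE q in distr M borel (X s). 0 < q \<and> q < 1" unfolding uniform[OF s] by (rule AE_unif)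
  then show "AE \<omega> in M. 0 < X s \<omega> \<and> X s \<omega> < 1" by (rule AE_distrD[rotated]) (use s in auto)
qed

lemma AE_X_ne: "finite F \<Longrightarrow> AE \<omega> in M. \<forall>s\<in>I. X s \<omega> \<notin> F"
proof (rule AE_finite_allI[OF finite_I])
  fix s assume F: "finite F" and s: "s \<in> I"
  have "AE q in unif. \<forall>c\<in>F. q \<noteq> c"
  proof (rule AE_finite_allI[OF F])
    fix c
    have "measure unif {c} \<le> 0" using unif_interval_le[of 0 c] by simp
    then have "measure unif {c} = 0" using measure_nonneg[of unif "{c}"] by linarith
    then have "emeasure unif {c} = 0"
      by (simp add: finite_measure.emeasure_eq_measure prob_space.finite_measure prob_space_unif)
    then show "AE q in unif. q \<noteq> c" by (intro AE_I[of _ _ "{c}"]) auto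
  qed
  then have "AE q in distr M borel (X s). q \<notin> F" unfolding uniform[OF s] by eventually_elim blast
  then show "AE \<omega> in M. X s \<omega> \<notin> F" by (rule AE_distrD[rotated]) (use s in auto)
qed

context
  fixes S :: "nat set" and E :: "real set"
  assumes S: "S \<subseteq> I" and E [measurable]: "E \<in> sets borel"
begin

definition hits :: "'w \<Rightarrow> real" where
  "hits \<omega> = (\<Sum>s\<in>S. indicator E (X s \<omega>))"

lemma indep_hits: "indep_vars (\<lambda>_. borel) (\<lambda>s \<omega>. indicator E (X s \<omega>) :: real) S"
  using indep_vars_compose2[OF indep_vars_subset[OF indep S], of "\<lambda>_. indicator E" "\<lambda>_. borel"] by simp

lemma expectation_hit: "s \<in> S \<Longrightarrow> expectation (\<lambda>\<omega>. indicator E (X s \<omega>)) = measure unif E"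
proof -
  assume s: "s \<in> S"
  have "expectation (\<lambda>\<omega>. indicator E (X s \<omega>)) = expectation (indicator {\<omega> \<in> space M. X s \<omega> \<in> E})"
    by (rule Bochner_Integration.integral_cong) (auto simp: indicator_def)
  also have "\<dots> = prob {\<omega> \<in> space M. X s \<omega> \<in> E}"     by (subst Bochner_Integration.integral_indicator) (auto intro!: arg_cong[where f=prob])
  finally show ?thesis using prob_X[of s E] s S E by auto
qed

lemma Hoeffding_hits:
  assumes "S \<noteq> {}" "0 \<le> e"
  shows "prob {\<omega> \<in> space M. card S * measure unif E + e \<le> hits \<omega>} \<le> exp (- 2 * e\<^sup>2 / card S)"
    and "prob {\<omega> \<in> space M. hits \<omega> \<le> card S * measure unif E - e} \<le> exp (- 2 * e\<^sup>2 / card S)"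
proof -
  have finS: "finite S" using S finite_I finite_subset by blast
  have c: "0 < card S" using finS assms by (simp add: card_gt_0_iff)
  have mu: "(\<Sum>s\<in>S. expectation (\<lambda>\<omega>. indicator E (X s \<omega>))) = card S * measure unif E"
    by (simp add: expectation_hit)
  interpret H: Hoeffding_ineq M S "\<lambda>s \<omega>. indicator E (X s \<omega>)" "\<lambda>_. 0" "\<lambda>_. 1" "card S * measure unif E"
  proof unfold_locales
    show "finite S" by (rule finS)
    show "indep_vars (\<lambda>_. borel) (\<lambda>s \<omega>. indicator E (X s \<omega>) :: real) S" by (rule indep_hits)
    show "card S * measure unif E \<equiv> \<Sum>s\<in>S. expectation (\<lambda>\<omega>. indicator E (X s \<omega>))"
      using mu by simp
  qed (auto simp: indicator_def)
  show "prob {\<omega> \<in> space M. card S * measure unif E + e \<le> hits \<omega>} \<le> exp (- 2 * e\<^sup>2 / card S)"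
    using H.Hoeffding_ineq_ge[OF assms(2)] c unfolding hits_def by simp
  show "prob {\<omega> \<in> space M. hits \<omega> \<le> card S * measure unif E - e} \<le> exp (- 2 * e\<^sup>2 / card S)"
    using H.Hoeffding_ineq_le[OF assms(2)] c unfolding hits_def by simp
qed

end

text \<open>
  The cross terms vanish by independence, so each summand contributes at most \<open>1\<close>.
\<close>

lemma second_moment_sum:
  assumes "finite S" "indep_vars (\<lambda>_. borel) W S"
    and "\<And>s \<omega>. s \<in> S \<Longrightarrow> \<bar>W s \<omega>\<bar> \<le> (1::real)" and "\<And>s. s \<in> S \<Longrightarrow> expectation (W s) = 0"
  shows "expectation (\<lambda>\<omega>. (\<Sum>s\<in>S. W s \<omega>)\<^sup>2) \<le> card S"
  using assms
proof (induction S rule: finite_induct)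
  case (insert s S)
  have [measurable]: "W i \<in> borel_measurable M" if "i \<in> insert s S" for i
    using insert.prems(1) that by (auto simp: indep_vars_def)
  define Z where "Z \<omega> = (\<Sum>s\<in>S. W s \<omega>)" for \<omega>
  have [measurable]: "Z \<in> borel_measurable M" unfolding Z_def by measurable
  have Zb: "\<bar>Z \<omega>\<bar> \<le> card S" for \<omega>
  proof -
    have "\<bar>Z \<omega>\<bar> \<le> (\<Sum>s\<in>S. \<bar>W s \<omega>\<bar>)" unfolding Z_def by (rule sum_abs)
    also have "\<dots> \<le> of_nat (card S) * 1" using insert.prems by (intro sum_bounded_above) auto
    finally show ?thesis by simp
  qed
  have Wb: "\<bar>W s \<omega>\<bar> \<le> 1" for \<omega> using insert.prems by simp
  have iZ: "integrable M Z" by (rule integrable_const_bound[of _ "card S"]) (use Zb in auto)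
  have iW: "integrable M (W s)" by (rule integrable_const_bound[of _ 1]) (use Wb in auto)
  have iZ2: "integrable M (\<lambda>\<omega>. (Z \<omega>)\<^sup>2)"
    by (rule integrable_const_bound[of _ "(card S)\<^sup>2"]) (use Zb in \<open>auto simp: power2_le_iff_abs_le abs_le_square_iff[symmetric]\<close>)
  have W2: "(W s \<omega>)\<^sup>2 \<le> 1" for \<omega> using Wb[of \<omega>] by (simp add: abs_square_le_1)
  have iW2: "integrable M (\<lambda>\<omega>. (W s \<omega>)\<^sup>2)"
    by (rule integrable_const_bound[of _ 1]) (use W2 in auto)
  have ind: "indep_var borel (W s) borel Z"
    unfolding Z_def by (rule indep_vars_sum[OF insert.hyps(1,2) insert.prems(1)])
  have EWZ: "expectation (\<lambda>\<omega>. W s \<omega> * Z \<omega>) = 0"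
    using indep_var_lebesgue_integral[OF ind iW iZ] insert.prems(3)[of s] by simp
  have iWZ: "integrable M (\<lambda>\<omega>. W s \<omega> * Z \<omega>)" by (rule indep_var_integrable[OF ind iW iZ])
  have IH: "expectation (\<lambda>\<omega>. (Z \<omega>)\<^sup>2) \<le> card S"
    unfolding Z_def using insert.prems by (intro insert.IH indep_vars_subset[OF insert.prems(1)]) auto
  have EW2: "expectation (\<lambda>\<omega>. (W s \<omega>)\<^sup>2) \<le> 1"
    using integral_mono[OF iW2 integrable_const[of 1]] W2 by (simp add: prob_space)
  have "expectation (\<lambda>\<omega>. (\<Sum>s\<in>insert s S. W s \<omega>)\<^sup>2)
      = expectation (\<lambda>\<omega>. (W s \<omega>)\<^sup>2 + 2 * (W s \<omega> * Z \<omega>) + (Z \<omega>)\<^sup>2)"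
    using insert.hyps by (intro Bochner_Integration.integral_cong) (auto simp: Z_def power2_sum algebra_simps)
  also have "\<dots> = expectation (\<lambda>\<omega>. (W s \<omega>)\<^sup>2) + 2 * expectation (\<lambda>\<omega>. W s \<omega> * Z \<omega>) + expectation (\<lambda>\<omega>. (Z \<omega>)\<^sup>2)"
    using iW2 iWZ iZ2 by simp
  also have "\<dots> \<le> card (insert s S)" using EWZ IH EW2 insert.hyps by simp
  finally show ?case .
qed simp

lemma mean_deviation_hits:
  assumes S: "S \<subseteq> I" and E[measurable]: "E \<in> sets borel"
  shows "expectation (\<lambda>\<omega>. \<bar>hits S E \<omega> - card S * measure unif E\<bar>) \<le> sqrt (card S)"
proof (cases "S = {}")
  case True
  then have "hits S E = (\<lambda>_. 0)" using hits_def[OF S E] by auto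
  then show ?thesis using True by simp
next
  case False
  have finS: "finite S" using S finite_I finite_subset by blast
  define c where "c = sqrt (card S)"
  have c: "0 < c" "c\<^sup>2 = card S" using finS False by (auto simp: c_def card_gt_0_iff)
  define q where "q = measure unif E"
  interpret U: prob_space unif by (rule prob_space_unif)
  have q: "0 \<le> q" "q \<le> 1" by (auto simp: q_def)
  define W where "W s \<omega> = indicator E (X s \<omega>) - q" for s \<omega>
  have Wm[measurable]: "W s \<in> borel_measurable M" if "s \<in> S" for s
  proof -
    have [measurable]: "X s \<in> borel_measurable M" using that S by auto
    show ?thesis unfolding W_def by measurable
  qed
  have indW: "indep_vars (\<lambda>_. borel) W S"
    unfolding W_def using indep_vars_compose2[OF indep_hits[OF S E], of "\<lambda>_ y. y - q" "\<lambda>_. borel"] by simp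
  have Wb: "\<bar>W s \<omega>\<bar> \<le> 1" for s \<omega> using q by (auto simp: W_def indicator_def)
  have iI: "integrable M (\<lambda>\<omega>. indicator E (X s \<omega>) :: real)" if "s \<in> S" for s
    by (rule integrable_const_bound[of _ 1]) (use that S in auto)
  have EW: "expectation (W s) = 0" if "s \<in> S" for s
    unfolding W_def using iI[OF that] expectation_hit[OF S E that] by (simp add: q_def prob_space)
  define Z where "Z \<omega> = (\<Sum>s\<in>S. W s \<omega>)" for \<omega>
  have [measurable]: "Z \<in> borel_measurable M" unfolding Z_def by measurable
  have Zb: "\<bar>Z \<omega>\<bar> \<le> card S" for \<omega>
  proof -
    have "\<bar>Z \<omega>\<bar> \<le> (\<Sum>s\<in>S. \<bar>W s \<omega>\<bar>)" unfolding Z_def by (rule sum_abs)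
    also have "\<dots> \<le> of_nat (card S) * 1" using Wb by (intro sum_bounded_above) auto
    finally show ?thesis by simp
  qed
  have iZ: "integrable M (\<lambda>\<omega>. \<bar>Z \<omega>\<bar>)" by (rule integrable_const_bound[of _ "card S"]) (use Zb in auto)
  have iZ2: "integrable M (\<lambda>\<omega>. (Z \<omega>)\<^sup>2)"
    by (rule integrable_const_bound[of _ "(card S)\<^sup>2"]) (use Zb in \<open>auto simp: abs_le_square_iff[symmetric]\<close>)
  have E2: "expectation (\<lambda>\<omega>. (Z \<omega>)\<^sup>2) \<le> c\<^sup>2"
    unfolding Z_def c(2) by (rule second_moment_sum[OF finS indW Wb EW])
  \<comment> \<open>Jensen's inequality for the square root, through its tangent at the second-moment bound.\<close>
  have amgm: "\<bar>Z \<omega>\<bar> \<le> (Z \<omega>)\<^sup>2 / (2 * c) + c / 2" for \<omega>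
  proof -
    have "0 \<le> (\<bar>Z \<omega>\<bar> - c)\<^sup>2" by simp
    then have "2 * c * \<bar>Z \<omega>\<bar> \<le> (Z \<omega>)\<^sup>2 + c\<^sup>2" by (simp add: power2_diff mult_ac)
    then show ?thesis using c(1) by (simp add: field_simps power2_eq_square)
  qed
  have "expectation (\<lambda>\<omega>. \<bar>Z \<omega>\<bar>) \<le> expectation (\<lambda>\<omega>. (Z \<omega>)\<^sup>2 / (2 * c) + c / 2)"
    by (rule integral_mono) (use iZ iZ2 amgm in auto)
  also have "\<dots> = expectation (\<lambda>\<omega>. (Z \<omega>)\<^sup>2) / (2 * c) + c / 2" using iZ2 by (simp add: prob_space)
  also have "\<dots> \<le> c\<^sup>2 / (2 * c) + c / 2" using E2 c(1) by (intro add_right_mono divide_right_mono) auto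
  also have "\<dots> = c" using c(1) by (simp add: power2_eq_square)
  also have "(\<lambda>\<omega>. \<bar>Z \<omega>\<bar>) = (\<lambda>\<omega>. \<bar>hits S E \<omega> - card S * measure unif E\<bar>)"
    by (simp add: Z_def W_def hits_def[OF S E] sum_subtractf q_def)
  finally show ?thesis unfolding c_def .
qed

text \<open>
  The value \<open>g\<close> of the first block selects which functional of the second block is integrated.
  Splitting over the finitely many values of \<open>g\<close> and using independence, the expectation is an
  average of the expectations for fixed \<open>b\<close>.
\<close>

lemma expectation_decoupled:
  fixes g :: "(nat \<Rightarrow> real) \<Rightarrow> nat" and \<phi> :: "nat \<Rightarrow> (nat \<Rightarrow> real) \<Rightarrow> real"
  assumes KJ: "K \<subseteq> I" "J \<subseteq> I" "K \<inter> J = {}"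
    and g: "g \<in> PiM K (\<lambda>_. borel) \<rightarrow>\<^sub>M count_space UNIV" "\<And>y. g y \<le> B"
    and \<phi>: "\<And>b. \<phi> b \<in> PiM J (\<lambda>_. borel) \<rightarrow>\<^sub>M borel" "\<And>b z. \<bar>\<phi> b z\<bar> \<le> c"
    and le: "\<And>b. b \<le> B \<Longrightarrow> expectation (\<lambda>\<omega>. \<phi> b (\<lambda>s\<in>J. X s \<omega>)) \<le> \<kappa>"
  shows "expectation (\<lambda>\<omega>. \<phi> (g (\<lambda>s\<in>K. X s \<omega>)) (\<lambda>s\<in>J. X s \<omega>)) \<le> \<kappa>"
proof -
  let ?Y = "\<lambda>\<omega>. \<lambda>s\<in>K. X s \<omega>" and ?Z = "\<lambda>\<omega>. \<lambda>s\<in>J. X s \<omega>"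
  have ind: "indep_var (PiM K (\<lambda>_. borel)) ?Y (PiM J (\<lambda>_. borel)) ?Z"
    by (rule indep_var_restrict[OF indep KJ(3,1,2)])
  have Ym[measurable]: "?Y \<in> M \<rightarrow>\<^sub>M PiM K (\<lambda>_. borel)" and Zm[measurable]: "?Z \<in> M \<rightarrow>\<^sub>M PiM J (\<lambda>_. borel)"
    using KJ by (auto intro!: measurable_restrict)
  note [measurable] = g(1) \<phi>(1)
  have gY[measurable]: "(\<lambda>\<omega>. g (?Y \<omega>)) \<in> M \<rightarrow>\<^sub>M count_space UNIV" by measurable
  have G[measurable]: "{\<omega> \<in> space M. g (?Y \<omega>) = b} \<in> sets M" for b
    using measurable_sets[OF gY, of "{b}"] by (simp add: vimage_def Int_def conj_commute)
  have iY: "integrable M (\<lambda>\<omega>. indicator {b} (g (?Y \<omega>)) :: real)" for b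
    using measurable_compose[OF gY, of "indicator {b}" borel]
    by (intro integrable_const_bound[of _ 1]) (auto simp: comp_def)
  have iZ: "integrable M (\<lambda>\<omega>. \<phi> b (?Z \<omega>))" for b
    by (rule integrable_const_bound[of _ c]) (use \<phi>(2) in auto)
  have indb: "indep_var borel (\<lambda>\<omega>. indicator {b} (g (?Y \<omega>)) :: real) borel (\<lambda>\<omega>. \<phi> b (?Z \<omega>))" for b
    using indep_var_compose[OF ind, of "\<lambda>y. indicator {b} (g y) :: real" borel "\<phi> b" borel]
      measurable_compose[OF g(1), of "indicator {b}" borel] \<phi>(1)
    by (simp add: comp_def)
  have Eb: "expectation (\<lambda>\<omega>. indicator {b} (g (?Y \<omega>)) * \<phi> b (?Z \<omega>))
      = expectation (\<lambda>\<omega>. indicator {b} (g (?Y \<omega>))) * expectation (\<lambda>\<omega>. \<phi> b (?Z \<omega>))" for b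
    by (rule indep_var_lebesgue_integral[OF indb iY iZ])
  have ib: "integrable M (\<lambda>\<omega>. indicator {b} (g (?Y \<omega>)) * \<phi> b (?Z \<omega>))" for b
    by (rule indep_var_integrable[OF indb iY iZ])
  have one: "(\<Sum>b\<le>B. expectation (\<lambda>\<omega>. indicator {b} (g (?Y \<omega>)) :: real)) = 1"
  proof -
    have "(\<Sum>b\<le>B. expectation (\<lambda>\<omega>. indicator {b} (g (?Y \<omega>)) :: real))
        = expectation (\<lambda>\<omega>. \<Sum>b\<le>B. indicator {b} (g (?Y \<omega>)))"
      using iY by (subst Bochner_Integration.integral_sum) auto
    also have "\<dots> = expectation (\<lambda>\<omega>. 1)"
      using g(2) by (intro Bochner_Integration.integral_cong) (auto simp: indicator_def)
    finally show ?thesis by (simp add: prob_space)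
  qed
  have "expectation (\<lambda>\<omega>. \<phi> (g (?Y \<omega>)) (?Z \<omega>))
      = expectation (\<lambda>\<omega>. \<Sum>b\<le>B. indicator {b} (g (?Y \<omega>)) * \<phi> b (?Z \<omega>))"
    using g(2) by (intro Bochner_Integration.integral_cong) (auto simp: indicator_def if_distrib[of "\<lambda>x. x * _"] sum.delta cong: if_cong)
  also have "\<dots> = (\<Sum>b\<le>B. expectation (\<lambda>\<omega>. indicator {b} (g (?Y \<omega>)) * \<phi> b (?Z \<omega>)))"
    using ib by (intro Bochner_Integration.integral_sum) auto
  also have "\<dots> = (\<Sum>b\<le>B. expectation (\<lambda>\<omega>. indicator {b} (g (?Y \<omega>))) * expectation (\<lambda>\<omega>. \<phi> b (?Z \<omega>)))"
    using Eb by simp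
  also have "\<dots> \<le> (\<Sum>b\<le>B. expectation (\<lambda>\<omega>. indicator {b} (g (?Y \<omega>))) * \<kappa>)"
    by (intro sum_mono mult_left_mono le) auto
  also have "\<dots> = \<kappa>" unfolding sum_distrib_right[symmetric] one by simp
  finally show ?thesis .
qed

end

section \<open>Measurability of the policy\<close>

context clustered_problem
begin

lemma budget_cong:
  "(\<And>s. s \<in> {1..<t} \<Longrightarrow> x s = y s) \<Longrightarrow> CwG_budget T B \<epsilon>0 p x t = CwG_budget T B \<epsilon>0 p y t"
proof (induction t rule: less_induct)
  case (less t)
  consider "t = 0" | "t = Suc 0" | k where "t = Suc (Suc k)" by (metis nat.exhaust)
  then show ?case
  proof cases
    case 3
    have IH: "CwG_budget T B \<epsilon>0 p x j = CwG_budget T B \<epsilon>0 p y j" if "j \<le> Suc k" for j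
      using that less 3 by auto
    have xy: "x (Suc k) = y (Suc k)" using less.prems 3 by auto
    have "CwG_accepts T B \<epsilon>0 p x (Suc k) = CwG_accepts T B \<epsilon>0 p y (Suc k)"
      using IH[of "Suc k"] IH[of "t0 + 1"] xy by (simp add: CwG_accepts_def)
    then show ?thesis using IH[of "Suc k"] unfolding 3 by (subst (1 2) budget_Suc) auto
  qed auto
qed

lemma threshold_measurable:
  assumes "\<And>j. 1 \<le> j \<Longrightarrow> j \<le> t \<Longrightarrow> (\<lambda>\<omega>. CwG_budget T B \<epsilon>0 p (x \<omega>) j) \<in> N \<rightarrow>\<^sub>M count_space UNIV"
    and t: "1 \<le> t"
  shows "(\<lambda>\<omega>. CwG_threshold T B \<epsilon>0 p (x \<omega>) t) \<in> borel_measurable N"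
proof (cases "t \<le> t0")
  case True
  have "(\<lambda>\<omega>. p t (CwG_budget T B \<epsilon>0 p (x \<omega>) t)) \<in> borel_measurable N"
    by (rule measurable_compose[OF assms(1)]) (use t in auto)
  then show ?thesis using True by simp
next
  case False
  have "(\<lambda>\<omega>. p_CE T (t0 + 1) (CwG_budget T B \<epsilon>0 p (x \<omega>) (t0 + 1))) \<in> borel_measurable N"
    by (rule measurable_compose[OF assms(1)]) (use False in auto)
  then show ?thesis using False by simp
qed

lemma accepts_measurable_aux:
  assumes b: "\<And>j. 1 \<le> j \<Longrightarrow> j \<le> t \<Longrightarrow> (\<lambda>\<omega>. CwG_budget T B \<epsilon>0 p (x \<omega>) j) \<in> N \<rightarrow>\<^sub>M count_space UNIV"
    and t: "1 \<le> t" and x[measurable]: "(\<lambda>\<omega>. x \<omega> t) \<in> borel_measurable N"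
  shows "Measurable.pred N (\<lambda>\<omega>. CwG_accepts T B \<epsilon>0 p (x \<omega>) t)"
proof -
  have [measurable]: "(\<lambda>\<omega>. CwG_threshold T B \<epsilon>0 p (x \<omega>) t) \<in> borel_measurable N"
    by (rule threshold_measurable[OF b t])
  have [measurable]: "(\<lambda>\<omega>. CwG_budget T B \<epsilon>0 p (x \<omega>) t) \<in> N \<rightarrow>\<^sub>M count_space UNIV" by (rule b[OF t order_refl])
  show ?thesis unfolding CwG_accepts_def by measurable
qed

lemma budget_measurable:
  "(\<And>s. s \<in> {1..<t} \<Longrightarrow> (\<lambda>\<omega>. x \<omega> s) \<in> borel_measurable N) \<Longrightarrow>
    (\<lambda>\<omega>. CwG_budget T B \<epsilon>0 p (x \<omega>) t) \<in> N \<rightarrow>\<^sub>M count_space UNIV"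
proof (induction t rule: less_induct)
  case (less t)
  consider "t = 0" | "t = Suc 0" | k where "t = Suc (Suc k)" by (metis nat.exhaust)
  then show ?case
  proof cases
    case 3
    have IH: "(\<lambda>\<omega>. CwG_budget T B \<epsilon>0 p (x \<omega>) j) \<in> N \<rightarrow>\<^sub>M count_space UNIV" if "j \<le> Suc k" for j
      by (rule less.IH) (use that less.prems 3 in auto)
    have [measurable]: "Measurable.pred N (\<lambda>\<omega>. CwG_accepts T B \<epsilon>0 p (x \<omega>) (Suc k))"
      by (rule accepts_measurable_aux) (use IH less.prems 3 in auto)
    have [measurable]: "(\<lambda>\<omega>. CwG_budget T B \<epsilon>0 p (x \<omega>) (Suc k)) \<in> N \<rightarrow>\<^sub>M count_space UNIV" by (rule IH) simp
    have eq: "(\<lambda>\<omega>. CwG_budget T B \<epsilon>0 p (x \<omega>) t) = (\<lambda>\<omega>. if CwG_accepts T B \<epsilon>0 p (x \<omega>) (Suc k)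
        then CwG_budget T B \<epsilon>0 p (x \<omega>) (Suc k) - 1 else CwG_budget T B \<epsilon>0 p (x \<omega>) (Suc k))"
      unfolding 3 by (rule ext, rule budget_Suc) simp
    show ?thesis unfolding eq by measurable
  qed auto
qed

lemma accepts_measurable:
  assumes "\<And>s. s \<in> {1..t} \<Longrightarrow> (\<lambda>\<omega>. x \<omega> s) \<in> borel_measurable N" "1 \<le> t"
  shows "Measurable.pred N (\<lambda>\<omega>. CwG_accepts T B \<epsilon>0 p (x \<omega>) t)"
  by (intro accepts_measurable_aux budget_measurable) (use assms in auto)

text \<open>
  Sums of indicators in place of cardinalities, for measurability and for Hoeffding's inequality.
\<close>

lemma bad_alt:
  "bad t b x \<longleftrightarrow> 0 < b \<and> b \<le> T - t \<and>
     (real b \<le> (\<Sum>s\<in>{Suc t..T}. indicator {p_CE T t b + radius t<..} (x s)) \<or>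
      (\<Sum>s\<in>{Suc t..T}. indicator {p_CE T t b - radius t..} (x s)) < real b)"
proof -
  have "(\<Sum>s\<in>{Suc t..T}. indicator E (x s)) = real (card {s \<in> {Suc t..T}. x s \<in> E})" for E
    by (subst card_filter_eq_sum) (auto simp: indicator_def)
  then show ?thesis unfolding bad_def by simp
qed

lemma step_loss_measurable:
  assumes x: "\<And>s. s \<in> {t..T} \<Longrightarrow> (\<lambda>\<omega>. x \<omega> s) \<in> borel_measurable N" and t: "t \<le> T"
  shows "(\<lambda>\<omega>. step_loss t b (x \<omega>)) \<in> borel_measurable N"
proof -
  have [measurable]: "(\<lambda>\<omega>. x \<omega> t) \<in> borel_measurable N" using x t by simp
  have [measurable]: "(\<lambda>\<omega>. x \<omega> s) \<in> borel_measurable N" if "s \<in> {Suc t..T}" for s using x that by simp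
  show ?thesis unfolding step_loss_def bad_alt by measurable
qed

lemma step_loss_bounds: "0 \<le> step_loss t b x" "step_loss t b x \<le> modulus (2 * radius t) + 1"
  using modulus_nonneg[of "2 * radius t"] by (auto simp: step_loss_def)

lemma step_loss_cong:
  assumes "\<And>s. s \<in> {t..T} \<Longrightarrow> x s = y s" "t \<le> T" shows "step_loss t b x = step_loss t b y"
proof -
  have "(\<Sum>s\<in>{Suc t..T}. indicator E (x s)) = (\<Sum>s\<in>{Suc t..T}. indicator E (y s) :: real)" for E
    by (rule sum.cong) (use assms(1) in auto)
  then have "bad t b x = bad t b y" unfolding bad_alt by simp
  then show ?thesis using assms unfolding step_loss_def by simp
qed

lemma exceedances_alt: "real (exceedances b x) = (\<Sum>s\<in>{Suc t0..T}. indicator {phase2_level b..} (x s))"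
  unfolding exceedances_def by (subst card_filter_eq_sum) (auto simp: indicator_def)

lemma phase2_loss_measurable:
  assumes x: "\<And>s. s \<in> {Suc t0..T} \<Longrightarrow> (\<lambda>\<omega>. x \<omega> s) \<in> borel_measurable N"
  shows "(\<lambda>\<omega>. phase2_loss b (x \<omega>)) \<in> borel_measurable N"
proof -
  note [measurable] = x
  show ?thesis unfolding phase2_loss_def exceedances_alt by measurable
qed

lemma phase2_loss_bounds: "0 \<le> phase2_loss b x" "phase2_loss b x \<le> T"
proof -
  have "exceedances b x \<le> card {Suc t0..T}" unfolding exceedances_def by (rule card_mono) auto
  then have "exceedances b x \<le> T - t0" by simp
  then show "phase2_loss b x \<le> T" unfolding phase2_loss_def by auto
  show "0 \<le> phase2_loss b x" unfolding phase2_loss_def by simp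
qed

lemma phase2_loss_cong:
  assumes "\<And>s. s \<in> {Suc t0..T} \<Longrightarrow> x s = y s" shows "phase2_loss b x = phase2_loss b y"
proof -
  have "(\<Sum>s\<in>{Suc t0..T}. indicator E (x s)) = (\<Sum>s\<in>{Suc t0..T}. indicator E (y s) :: real)" for E
    by (rule sum.cong) (use assms in auto)
  then show ?thesis unfolding phase2_loss_def exceedances_alt by simp
qed

definition step_bound :: "nat \<Rightarrow> real" where
  "step_bound t = modulus (2 * radius t) * (4 * radius t) + tail_mass (T - t + 1)"

end

section \<open>Expected losses\<close>

locale CwG_sample = clustered_problem + S: uniform_sample M X "{1..T}" for M :: "'w measure" and X
begin

abbreviation path :: "'w \<Rightarrow> nat \<Rightarrow> real" where "path \<omega> \<equiv> \<lambda>s. X s \<omega>"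

text \<open>
  The expected number of later levels above \<open>u = p_CE T t b + radius t\<close> is below \<open>b\<close> by at least
  \<open>(T - t) * radius t\<close>, because \<open>(T - t) * (1 - p_CE T t b) = (T - t) * b / (T - t + 1)\<close> is below \<open>b\<close>.
  If \<open>u \<ge> 1\<close> there are almost surely no such levels.
\<close>

lemma prob_bad_high:
  assumes t: "1 \<le> t" and b: "0 < b" "b \<le> T - t"
  shows "S.prob {\<omega> \<in> space M. real b \<le> (\<Sum>s\<in>{Suc t..T}. indicator {p_CE T t b + radius t<..} (X s \<omega>))}
       \<le> exp (- 2 * (real (T - t) * radius t)\<^sup>2 / real (T - t))"
proof -
  define u where "u = p_CE T t b + radius t"
  have sub: "{Suc t..T} \<subseteq> {1..T}" and tT: "t < T" using b by auto
  let ?h = "S.hits {Suc t..T} {u<..}"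
  have hits: "?h \<omega> = (\<Sum>s\<in>{Suc t..T}. indicator {u<..} (X s \<omega>))" for \<omega>
    by (rule S.hits_def[OF sub]) simp
  have r: "0 \<le> radius t" using tT radius_nonneg by simp
  have CE: "p_CE T t b = 1 - real b / (real (T - t) + 1)"
    using tT unfolding p_CE_def by (simp add: of_nat_diff)
  have u0: "0 < u"
  proof -
    have "real b / (real (T - t) + 1) < 1" using b by (simp add: field_simps)
    then show ?thesis using r unfolding u_def CE by linarith
  qed
  show ?thesis
  proof (cases "u < 1")
    case False
    have "S.prob {\<omega> \<in> space M. real b \<le> ?h \<omega>} = S.prob {}"
    proof (rule S.finite_measure_eq_AE)
      show "AE \<omega> in M. (\<omega> \<in> {\<omega> \<in> space M. real b \<le> ?h \<omega>}) = (\<omega> \<in> {})"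
        using S.AE_X
      proof eventually_elim
        case (elim \<omega>)
        have "?h \<omega> = 0" unfolding hits
        proof (rule sum.neutral, rule ballI)
          fix s assume "s \<in> {Suc t..T}"
          then have "X s \<omega> < 1" using elim by simp
          then show "indicator {u<..} (X s \<omega>) = (0::real)" using False by simp
        qed
        then show ?case using b by simp
      qed
      show "{\<omega> \<in> space M. real b \<le> ?h \<omega>} \<in> sets M"
      proof -
        have [measurable]: "X s \<in> borel_measurable M" if "s \<in> {Suc t..T}" for s using that by auto
        show ?thesis unfolding hits by measurable
      qed
    qed auto
    then show ?thesis unfolding hits unfolding u_def by simp
  next
    case True
    have q: "measure unif {u<..} = 1 - u" using True u0 by (intro unif_greaterThan) auto
    have "real (T - t) * (1 - u) + real (T - t) * radius t \<le> real b"
      unfolding u_def CE by (simp add: field_simps)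
    then have "S.prob {\<omega> \<in> space M. real b \<le> ?h \<omega>}
      \<le> S.prob {\<omega> \<in> space M. real (card {Suc t..T}) * measure unif {u<..} + real (T - t) * radius t \<le> ?h \<omega>}"
    proof (intro S.finite_measure_mono)
      have [measurable]: "X s \<in> borel_measurable M" if "s \<in> {Suc t..T}" for s using that by auto
      show "{\<omega> \<in> space M. real (card {Suc t..T}) * measure unif {u<..} + real (T - t) * radius t \<le> ?h \<omega>} \<in> sets M"
        unfolding hits by measurable
    qed (auto simp: q)
    also have "\<dots> \<le> exp (- 2 * (real (T - t) * radius t)\<^sup>2 / real (card {Suc t..T}))"
      by (rule S.Hoeffding_hits(1)[OF sub]) (use tT r in auto)
    finally show ?thesis unfolding hits unfolding u_def by simp
  qed
qed

text \<open>
  The mirror image of the previous estimate.  Since the count is an integer, falling short of \<open>b\<close>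
  means being at most \<open>b - 1\<close>, and this unit pays for the difference between \<open>T - t\<close> and \<open>T - t + 1\<close>
  in the mean.
\<close>

lemma prob_bad_low:
  assumes t: "1 \<le> t" and b: "0 < b" "b \<le> T - t"
  shows "S.prob {\<omega> \<in> space M. (\<Sum>s\<in>{Suc t..T}. indicator {p_CE T t b - radius t..} (X s \<omega>)) < real b}
       \<le> exp (- 2 * (real (T - t) * radius t)\<^sup>2 / real (T - t))"
proof -
  define l where "l = p_CE T t b - radius t"
  have sub: "{Suc t..T} \<subseteq> {1..T}" and tT: "t < T" using b by auto
  let ?h = "S.hits {Suc t..T} {l..}"
  have hits: "?h \<omega> = (\<Sum>s\<in>{Suc t..T}. indicator {l..} (X s \<omega>))" for \<omega>
    by (rule S.hits_def[OF sub]) simp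
  have r: "0 \<le> radius t" using tT radius_nonneg by simp
  have CE: "p_CE T t b = 1 - real b / (real (T - t) + 1)"
    using tT unfolding p_CE_def by (simp add: of_nat_diff)
  have l1: "l \<le> 1"
  proof -
    have "0 \<le> real b / (real (T - t) + 1)" by simp
    then show ?thesis using r unfolding l_def CE by linarith
  qed
  have [measurable]: "X s \<in> borel_measurable M" if "s \<in> {Suc t..T}" for s using that by auto
  show ?thesis
  proof (cases "0 < l")
    case False
    have "S.prob {\<omega> \<in> space M. ?h \<omega> < real b} = S.prob {}"
    proof (rule S.finite_measure_eq_AE)
      show "AE \<omega> in M. (\<omega> \<in> {\<omega> \<in> space M. ?h \<omega> < real b}) = (\<omega> \<in> {})"
        using S.AE_X
      proof eventually_elim
        case (elim \<omega>)
        have "?h \<omega> = (\<Sum>s\<in>{Suc t..T}. 1)" unfolding hits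
        proof (rule sum.cong[OF refl])
          fix s assume "s \<in> {Suc t..T}"
          then have "0 < X s \<omega>" using elim by simp
          then show "indicator {l..} (X s \<omega>) = (1::real)" using False by simp
        qed
        then have "?h \<omega> = real (T - t)" by simp
        moreover have "real b \<le> real (T - t)" using b(2) by (rule of_nat_mono)
        ultimately have "\<not> ?h \<omega> < real b" by linarith
        then show ?case by simp
      qed
      show "{\<omega> \<in> space M. ?h \<omega> < real b} \<in> sets M" unfolding hits by measurable
    qed auto
    then show ?thesis unfolding hits unfolding l_def by simp
  next
    case True
    have q: "measure unif {l..} = 1 - l" using True l1 by (intro unif_atLeast) auto
    have "real b - 1 \<le> real (T - t) * (1 - l) - real (T - t) * radius t"
    proof -
      have "real (T - t) * (1 - l) - real (T - t) * radius t = real b - real b / (real (T - t) + 1)"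
        unfolding l_def CE by (simp add: field_simps)
      moreover have "real b / (real (T - t) + 1) \<le> 1" using b by (simp add: field_simps)
      ultimately show ?thesis by simp
    qed
    moreover have "?h \<omega> \<le> real b - 1" if "?h \<omega> < real b" for \<omega>
    proof -
      have "?h \<omega> = real (card {s \<in> {Suc t..T}. X s \<omega> \<in> {l..}})"
        unfolding hits by (subst card_filter_eq_sum) (auto simp: indicator_def)
      moreover from this that have "Suc (card {s \<in> {Suc t..T}. X s \<omega> \<in> {l..}}) \<le> b" by simp
      then have "real (Suc (card {s \<in> {Suc t..T}. X s \<omega> \<in> {l..}})) \<le> real b" by (rule of_nat_mono)
      ultimately show ?thesis by simp
    qed
    ultimately have "S.prob {\<omega> \<in> space M. ?h \<omega> < real b}
      \<le> S.prob {\<omega> \<in> space M. ?h \<omega> \<le> real (card {Suc t..T}) * measure unif {l..} - real (T - t) * radius t}"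
    proof (intro S.finite_measure_mono)
      show "{\<omega> \<in> space M. ?h \<omega> \<le> real (card {Suc t..T}) * measure unif {l..} - real (T - t) * radius t} \<in> sets M"
        unfolding hits by measurable
    qed (force simp: q)+
    also have "\<dots> \<le> exp (- 2 * (real (T - t) * radius t)\<^sup>2 / real (card {Suc t..T}))"
      by (rule S.Hoeffding_hits(2)[OF sub]) (use tT r in auto)
    finally show ?thesis unfolding hits unfolding l_def by simp
  qed
qed

text \<open>
  The factor \<open>2\<close> in the radius gives the exponent \<open>4 (N - 1) ln N / N\<close>, which is at least \<open>2 ln N\<close> for
  \<open>N = T - t + 1 \<ge> 2\<close>.
\<close>

lemma Hoeffding_radius:
  assumes t: "t < T"
  shows "exp (- 2 * (real (T - t) * radius t)\<^sup>2 / real (T - t)) \<le> 1 / (real (T - t + 1))\<^sup>2"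
proof -
  define m where "m = real (T - t)"
  define N where "N = m + 1"
  have m: "1 \<le> m" using t unfolding m_def by simp
  have r2: "(radius t)\<^sup>2 = 2 * ln N / N"
    using t m unfolding radius_def N_def m_def by (simp add: of_nat_diff)
  have "2 * m / N \<ge> 1" using m unfolding N_def by (simp add: field_simps)
  moreover have "0 \<le> ln N" using m unfolding N_def by simp
  ultimately have "2 * ln N * 1 \<le> 2 * ln N * (2 * m / N)" by (intro mult_left_mono) auto
  also have "\<dots> = 2 * (m * radius t)\<^sup>2 / m"
    unfolding power_mult_distrib r2 using m by (simp add: power2_eq_square field_simps)
  finally have "- 2 * (m * radius t)\<^sup>2 / m \<le> - (2 * ln N)" by simp
  then have "exp (- 2 * (m * radius t)\<^sup>2 / m) \<le> exp (- (2 * ln N))" by (subst exp_le_cancel_iff)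
  also have "\<dots> = 1 / N\<^sup>2"
  proof -
    have "exp (2 * ln N) = N\<^sup>2" using m unfolding N_def by (simp add: exp_double)
    then show ?thesis by (simp add: exp_minus field_simps)
  qed
  finally show ?thesis unfolding m_def N_def by (simp add: of_nat_Suc add.commute)
qed

lemma prob_bad:
  assumes t: "t \<in> {1..T}"
  shows "S.prob {\<omega> \<in> space M. bad t b (path \<omega>)} \<le> tail_mass (T - t + 1)"
proof (cases "0 < b \<and> b \<le> T - t")
  case False
  then have "{\<omega> \<in> space M. bad t b (path \<omega>)} = {}" unfolding bad_def by auto
  then show ?thesis unfolding tail_mass_def by (simp only: measure_empty) simp
next
  case True
  then have tT: "t < T" by auto
  let ?H = "{\<omega> \<in> space M. real b \<le> (\<Sum>s\<in>{Suc t..T}. indicator {p_CE T t b + radius t<..} (X s \<omega>))}"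
  let ?L = "{\<omega> \<in> space M. (\<Sum>s\<in>{Suc t..T}. indicator {p_CE T t b - radius t..} (X s \<omega>)) < real b}"
  have [measurable]: "X s \<in> borel_measurable M" if "s \<in> {Suc t..T}" for s using that by auto
  have [measurable]: "?H \<in> sets M" "?L \<in> sets M" by measurable
  have "{\<omega> \<in> space M. bad t b (path \<omega>)} = ?H \<union> ?L" unfolding bad_alt using True by blast
  then have "S.prob {\<omega> \<in> space M. bad t b (path \<omega>)} \<le> S.prob ?H + S.prob ?L"
    using measure_Un_le[of ?H M ?L] by simp
  also have "\<dots> \<le> 2 * exp (- 2 * (real (T - t) * radius t)\<^sup>2 / real (T - t))"
    using prob_bad_high[of t b] prob_bad_low[of t b] True t by simp
  also have "\<dots> \<le> 2 * (1 / (real (T - t + 1))\<^sup>2)" using Hoeffding_radius[OF tT] by simp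
  also have "\<dots> = tail_mass (T - t + 1)" using tT unfolding tail_mass_def by simp
  finally show ?thesis .
qed

lemma expected_step_loss:
  assumes t: "t \<in> {1..T}"
  shows "S.expectation (\<lambda>\<omega>. step_loss t b (path \<omega>)) \<le> step_bound t"
proof -
  let ?c = "modulus (2 * radius t)"
  let ?A = "{\<omega> \<in> space M. X t \<omega> \<in> {p t b - 2 * radius t..p t b + 2 * radius t}}"
  let ?B = "{\<omega> \<in> space M. bad t b (path \<omega>)}"
  have [measurable]: "X s \<in> borel_measurable M" if "s \<in> {Suc t..T}" for s using that by auto
  have [measurable]: "X t \<in> borel_measurable M" using t by auto
  have A[measurable]: "?A \<in> sets M" by measurable
  have B[measurable]: "?B \<in> sets M" unfolding bad_alt by measurable
  have r: "0 \<le> radius t" using t radius_nonneg by simp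
  have "S.expectation (\<lambda>\<omega>. step_loss t b (path \<omega>)) = S.expectation (\<lambda>\<omega>. ?c * indicator ?A \<omega> + indicator ?B \<omega>)"
    by (rule Bochner_Integration.integral_cong) (auto simp: step_loss_def indicator_def abs_le_iff)
  also have "\<dots> = ?c * S.prob ?A + S.prob ?B"
    by (subst Bochner_Integration.integral_add) (auto simp: S.emeasure_eq_measure)
  also have "\<dots> \<le> ?c * (4 * radius t) + tail_mass (T - t + 1)"
  proof (intro add_mono mult_left_mono prob_bad[OF t] modulus_nonneg)
    have "S.prob ?A = measure unif {p t b - 2 * radius t..p t b + 2 * radius t}" by (rule S.prob_X[OF t]) simp
    also have "\<dots> \<le> 2 * (2 * radius t)" by (rule unif_interval_le) (use r in simp)
    finally show "S.prob ?A \<le> 4 * radius t" by simp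
  qed
  finally show ?thesis unfolding step_bound_def .
qed

text \<open>
  The threshold \<open>1 - b / (T - t0)\<close> makes \<open>b\<close> the expected number of levels above it.
\<close>

lemma expected_phase2_loss: "S.expectation (\<lambda>\<omega>. phase2_loss b (path \<omega>)) \<le> sqrt (T - t0)"
proof (cases "b < T - t0")
  case False
  then show ?thesis unfolding phase2_loss_def by simp
next
  case True
  define h where "h = phase2_level b"
  have sub: "{Suc t0..T} \<subseteq> {1..T}" by auto
  have tT: "t0 < T" using True by simp
  have h: "h = 1 - real b / real (T - t0)" using tT unfolding h_def phase2_level_def p_CE_def by (simp add: of_nat_diff)
  have h01: "0 \<le> h" "h \<le> 1" using True unfolding h by (auto simp: field_simps)
  have mu: "real (card {Suc t0..T}) * measure unif {h..} = real b"
    using unif_atLeast[OF h01] tT unfolding h by simp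
  have "(\<lambda>\<omega>. phase2_loss b (path \<omega>)) = (\<lambda>\<omega>. \<bar>S.hits {Suc t0..T} {h..} \<omega> - real (card {Suc t0..T}) * measure unif {h..}\<bar>)"
    unfolding mu phase2_loss_def exceedances_alt h_def[symmetric] using True S.hits_def[OF sub, of "{h..}"] by auto
  then show ?thesis using S.mean_deviation_hits[OF sub, of "{h..}"] by simp
qed

lemma expected_step_loss_path:
  assumes t: "t \<in> {1..T}"
  shows "S.expectation (\<lambda>\<omega>. step_loss t (CwG_budget T B \<epsilon>0 p (path \<omega>) t) (path \<omega>)) \<le> step_bound t"
proof -
  let ?K = "{1..<t}" and ?J = "{t..T}"
  have tT: "t \<le> T" using t by simp
  have eqJ: "step_loss t b (\<lambda>s\<in>?J. X s \<omega>) = step_loss t b (path \<omega>)" for b \<omega>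
    by (rule step_loss_cong[OF _ tT]) auto
  have eqK: "CwG_budget T B \<epsilon>0 p (\<lambda>s\<in>?K. X s \<omega>) t = CwG_budget T B \<epsilon>0 p (path \<omega>) t" for \<omega>
    by (rule budget_cong) auto
  have "S.expectation (\<lambda>\<omega>. step_loss t (CwG_budget T B \<epsilon>0 p (\<lambda>s\<in>?K. X s \<omega>) t) (\<lambda>s\<in>?J. X s \<omega>)) \<le> step_bound t"
  proof (rule S.expectation_decoupled[where g = "\<lambda>x. CwG_budget T B \<epsilon>0 p x t" and \<phi> = "step_loss t" and B = B])
    show "(\<lambda>x. CwG_budget T B \<epsilon>0 p x t) \<in> PiM ?K (\<lambda>_. borel) \<rightarrow>\<^sub>M count_space UNIV"
      by (rule budget_measurable) simp
    show "step_loss t b \<in> PiM ?J (\<lambda>_. borel) \<rightarrow>\<^sub>M borel" for b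
      using step_loss_measurable[of t "\<lambda>x. x" "PiM ?J (\<lambda>_. borel)" b] tT by simp
    show "\<bar>step_loss t b z\<bar> \<le> modulus (2 * radius t) + 1" for b z
      using step_loss_bounds[of t b z] by simp
    show "S.expectation (\<lambda>\<omega>. step_loss t b (\<lambda>s\<in>?J. X s \<omega>)) \<le> step_bound t" for b
      unfolding eqJ by (rule expected_step_loss[OF t])
  qed (use t budget_le in auto)
  then show ?thesis unfolding eqJ eqK .
qed

lemma expected_phase2_loss_path:
  "S.expectation (\<lambda>\<omega>. phase2_loss (CwG_budget T B \<epsilon>0 p (path \<omega>) (Suc t0)) (path \<omega>)) \<le> sqrt (T - t0)"
proof -
  let ?K = "{1..<Suc t0}" and ?J = "{Suc t0..T}"
  have eqJ: "phase2_loss b (\<lambda>s\<in>?J. X s \<omega>) = phase2_loss b (path \<omega>)" for b \<omega>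
    by (rule phase2_loss_cong) auto
  have eqK: "CwG_budget T B \<epsilon>0 p (\<lambda>s\<in>?K. X s \<omega>) (Suc t0) = CwG_budget T B \<epsilon>0 p (path \<omega>) (Suc t0)" for \<omega>
    by (rule budget_cong) auto
  have "S.expectation (\<lambda>\<omega>. phase2_loss (CwG_budget T B \<epsilon>0 p (\<lambda>s\<in>?K. X s \<omega>) (Suc t0)) (\<lambda>s\<in>?J. X s \<omega>)) \<le> sqrt (T - t0)"
  proof (rule S.expectation_decoupled[where g = "\<lambda>x. CwG_budget T B \<epsilon>0 p x (Suc t0)" and \<phi> = phase2_loss and B = B])
    show "(\<lambda>x. CwG_budget T B \<epsilon>0 p x (Suc t0)) \<in> PiM ?K (\<lambda>_. borel) \<rightarrow>\<^sub>M count_space UNIV"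
      by (rule budget_measurable) simp
    show "phase2_loss b \<in> PiM ?J (\<lambda>_. borel) \<rightarrow>\<^sub>M borel" for b
      using phase2_loss_measurable[of "\<lambda>x. x" "PiM ?J (\<lambda>_. borel)" b] by simp
    show "\<bar>phase2_loss b z\<bar> \<le> real T" for b z
      using phase2_loss_bounds[of b z] by simp
    show "S.expectation (\<lambda>\<omega>. phase2_loss b (\<lambda>s\<in>?J. X s \<omega>)) \<le> sqrt (T - t0)" for b
      unfolding eqJ by (rule expected_phase2_loss)
  qed (use phase1_length_le budget_le in auto)
  then show ?thesis unfolding eqJ eqK .
qed

end

section \<open>The sampling model\<close>

context unit_distribution
begin

lemma sets_ability_draw_law [simp, measurable_cong]: "sets (ability_draw_law D) = sets (borel \<Otimes>\<^sub>M borel)"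
  unfolding ability_draw_law_eq by simp

lemma pair_measurable: "(\<lambda>q. (quantile D q, q)) \<in> unif \<rightarrow>\<^sub>M borel \<Otimes>\<^sub>M borel"
  by measurable

lemma prob_space_ability_draw_law: "prob_space (ability_draw_law D)"
  unfolding ability_draw_law_eq
  by (rule prob_space.prob_space_distr[OF prob_space_unif pair_measurable])

lemma distr_snd_ability_draw_law: "distr (ability_draw_law D) borel snd = unif"
proof -
  have "distr (ability_draw_law D) borel snd = distr unif borel (\<lambda>q. q)"
    unfolding ability_draw_law_eq by (subst distr_distr[OF _ pair_measurable]) (auto simp: comp_def)
  also have "\<dots> = distr unif unif (\<lambda>q. q)" by (rule distr_cong) auto
  finally show ?thesis by simp
qed

text \<open>
  The draw determines the ability, so every quantity of the model is a function of the draws.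
\<close>

lemma AE_fst_ability_draw_law: "AE z in ability_draw_law D. fst z = quantile D (snd z)"
  unfolding ability_draw_law_eq by (subst AE_distr_iff[OF pair_measurable]) auto

lemma prob_space_CwG_space: "prob_space (CwG_space D T)"
  unfolding CwG_space_def by (rule prob_space_PiM) (rule prob_space_ability_draw_law)

lemma coordinate_measurable: "t \<in> {1..T} \<Longrightarrow> (\<lambda>\<omega>. \<omega> t) \<in> CwG_space D T \<rightarrow>\<^sub>M borel \<Otimes>\<^sub>M borel"
  using measurable_component_singleton[of t "{1..T}" "\<lambda>_. ability_draw_law D"]
  unfolding CwG_space_def by (simp cong: measurable_cong_sets)

lemma draw_measurable: "t \<in> {1..T} \<Longrightarrow> (\<lambda>\<omega>. snd (\<omega> t)) \<in> borel_measurable (CwG_space D T)"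
  by (rule measurable_compose[OF coordinate_measurable measurable_snd])

lemma ability_measurable: "t \<in> {1..T} \<Longrightarrow> (\<lambda>\<omega>. fst (\<omega> t)) \<in> borel_measurable (CwG_space D T)"
  by (rule measurable_compose[OF coordinate_measurable measurable_fst])

lemma distr_coordinate: "t \<in> {1..T} \<Longrightarrow> distr (CwG_space D T) (ability_draw_law D) (\<lambda>\<omega>. \<omega> t) = ability_draw_law D"
  unfolding CwG_space_def by (rule distr_PiM_component) (auto intro: prob_space_ability_draw_law)

lemma AE_ability: "AE \<omega> in CwG_space D T. \<forall>t\<in>{1..T}. fst (\<omega> t) = quantile D (snd (\<omega> t))"
proof (rule AE_finite_allI)
  fix t assume "t \<in> {1..T}"
  then show "AE \<omega> in CwG_space D T. fst (\<omega> t) = quantile D (snd (\<omega> t))"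
    unfolding CwG_space_def
    by (intro AE_PiM_component[where P = "\<lambda>z. fst z = quantile D (snd z)"] AE_fst_ability_draw_law prob_space_ability_draw_law)
qed simp

lemma uniform_sample_CwG_space: "uniform_sample (CwG_space D T) (\<lambda>t \<omega>. snd (\<omega> t)) {1..T}"
proof -
  interpret P: prob_space "CwG_space D T" by (rule prob_space_CwG_space)
  have coord: "(\<lambda>\<omega>. \<omega> t) \<in> CwG_space D T \<rightarrow>\<^sub>M ability_draw_law D" if "t \<in> {1..T}" for t
    using coordinate_measurable[OF that] by (simp cong: measurable_cong_sets)
  have "P.indep_vars (\<lambda>_. ability_draw_law D) (\<lambda>t \<omega>. \<omega> t) {1..T}"
  proof (cases "T = 0")
    case True
    then show ?thesis unfolding P.indep_vars_def P.indep_sets_def by simp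
  next
    case False
    have "distr (CwG_space D T) (PiM {1..T} (\<lambda>_. ability_draw_law D)) (\<lambda>\<omega>. \<lambda>t\<in>{1..T}. \<omega> t)
        = distr (CwG_space D T) (CwG_space D T) (\<lambda>\<omega>. \<omega>)"
      by (rule distr_cong) (auto simp: CwG_space_def space_PiM PiE_restrict)
    also have "\<dots> = CwG_space D T" by simp
    also have "\<dots> = PiM {1..T} (\<lambda>t. distr (CwG_space D T) (ability_draw_law D) (\<lambda>\<omega>. \<omega> t))"
      by (subst (1) CwG_space_def) (rule PiM_cong, auto simp: distr_coordinate)
    finally show ?thesis
      using False coord by (subst P.indep_vars_iff_distr_eq_PiM') auto
  qed
  then have ind: "P.indep_vars (\<lambda>_. borel) (\<lambda>t \<omega>. snd (\<omega> t)) {1..T}"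
    by (rule P.indep_vars_compose2) simp
  show ?thesis
  proof (unfold_locales)
    show "P.indep_vars (\<lambda>_. borel) (\<lambda>t \<omega>. snd (\<omega> t)) {1..T}" by (rule ind)
    fix t assume t: "t \<in> {1..T}"
    have "distr (CwG_space D T) borel (\<lambda>\<omega>. snd (\<omega> t))
        = distr (distr (CwG_space D T) (ability_draw_law D) (\<lambda>\<omega>. \<omega> t)) borel snd"
      by (subst distr_distr[OF _ coord[OF t]]) (auto simp: comp_def)
    then show "distr (CwG_space D T) borel (\<lambda>\<omega>. snd (\<omega> t)) = unif"
      unfolding distr_coordinate[OF t] distr_snd_ability_draw_law .
  qed simp
qed

end

lemma topsum_measurable:
  assumes S: "finite S" and "\<And>s. s \<in> S \<Longrightarrow> (\<lambda>\<omega>. f \<omega> s) \<in> borel_measurable N"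
  shows "(\<lambda>\<omega>. topsum S b (f \<omega>)) \<in> borel_measurable N"
proof -
  have "{sum (f \<omega>) A |A. A \<subseteq> S \<and> card A \<le> b} = (\<lambda>A. sum (f \<omega>) A) ` {A. A \<subseteq> S \<and> card A \<le> b}" for \<omega>
    by auto
  moreover have "finite {A. A \<subseteq> S \<and> card A \<le> b}" using S by (rule_tac finite_subset[of _ "Pow S"]) auto
  ultimately show ?thesis
    unfolding topsum_def using assms by (auto intro!: borel_measurable_Max borel_measurable_sum)
qed

context clustered_problem
begin

lemma CwG_sample_CwG_space:
  "CwG_sample D C0 \<beta> \<epsilon>0 \<delta> n qs T p (CwG_space D T) (\<lambda>t \<omega>. snd (\<omega> t))"
  by (intro CwG_sample.intro clustered_problem_axioms uniform_sample_CwG_space)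

theorem CwG_regret_le: "CwG_regret D T B \<epsilon>0 p \<le> (\<Sum>t=1..t0. step_bound t) + sqrt (T - t0)"
proof -
  let ?M = "CwG_space D T"
  interpret W: CwG_sample D C0 \<beta> \<epsilon>0 \<delta> n qs T p ?M "\<lambda>t \<omega>. snd (\<omega> t)" by (rule CwG_sample_CwG_space)
  define x where "x \<omega> = (\<lambda>s. snd (\<omega> s))" for \<omega> :: "nat \<Rightarrow> real \<times> real"
  define f where "f \<omega> = (\<lambda>s. fst (\<omega> s))" for \<omega> :: "nat \<Rightarrow> real \<times> real"
  define opt where "opt \<omega> = offline_opt T B (f \<omega>)" for \<omega>
  define rew where "rew \<omega> = (\<Sum>t=1..T. f \<omega> t * of_bool (CwG_accepts T B \<epsilon>0 p (x \<omega>) t))" for \<omega>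
  define ls where "ls t \<omega> = step_loss t (CwG_budget T B \<epsilon>0 p (x \<omega>) t) (x \<omega>)" for t \<omega>
  define l2 where "l2 \<omega> = phase2_loss (CwG_budget T B \<epsilon>0 p (x \<omega>) (Suc t0)) (x \<omega>)" for \<omega>
  have xm: "(\<lambda>\<omega>. x \<omega> s) \<in> borel_measurable ?M" if "s \<in> {1..T}" for s
    unfolding x_def by (rule draw_measurable[OF that])
  have fm: "(\<lambda>\<omega>. f \<omega> s) \<in> borel_measurable ?M" if "s \<in> {1..T}" for s
    unfolding f_def by (rule ability_measurable[OF that])
  have opt_m: "opt \<in> borel_measurable ?M"
    unfolding opt_def offline_opt_eq by (rule topsum_measurable) (use fm in auto)
  have acc_m: "Measurable.pred ?M (\<lambda>\<omega>. CwG_accepts T B \<epsilon>0 p (x \<omega>) t)" if "t \<in> {1..T}" for t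
    by (rule accepts_measurable) (use xm that in auto)
  have rew_m: "rew \<in> borel_measurable ?M"
  proof -
    have [measurable]: "Measurable.pred ?M (\<lambda>\<omega>. CwG_accepts T B \<epsilon>0 p (x \<omega>) t)"
      "(\<lambda>\<omega>. f \<omega> t) \<in> borel_measurable ?M" if "t \<in> {1..T}" for t
      using acc_m fm that by auto
    show ?thesis unfolding rew_def by measurable
  qed
  have ls_m: "ls t \<in> borel_measurable ?M" if "t \<in> {1..t0}" for t
  proof -
    have "(\<lambda>\<omega>. CwG_budget T B \<epsilon>0 p (x \<omega>) t) \<in> ?M \<rightarrow>\<^sub>M count_space UNIV"
      by (rule budget_measurable) (use xm that phase1_length_le in auto)
    moreover have "(\<lambda>\<omega>. step_loss t b (x \<omega>)) \<in> borel_measurable ?M" for b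
      by (rule step_loss_measurable) (use xm that phase1_length_le in auto)
    ultimately show ?thesis unfolding ls_def by (rule measurable_compose_countable[rotated])
  qed
  have l2_m: "l2 \<in> borel_measurable ?M"
  proof -
    have "(\<lambda>\<omega>. CwG_budget T B \<epsilon>0 p (x \<omega>) (Suc t0)) \<in> ?M \<rightarrow>\<^sub>M count_space UNIV"
      by (rule budget_measurable) (use xm phase1_length_le in auto)
    moreover have "(\<lambda>\<omega>. phase2_loss b (x \<omega>)) \<in> borel_measurable ?M" for b
      by (rule phase2_loss_measurable) (use xm in auto)
    ultimately show ?thesis unfolding l2_def by (rule measurable_compose_countable[rotated])
  qed
  have good: "AE \<omega> in ?M. \<forall>s\<in>{1..T}. (0 < x \<omega> s \<and> x \<omega> s \<le> 1) \<and> x \<omega> s \<notin> qs ` {1..n} \<and> f \<omega> s = quantile D (x \<omega> s)"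
    using W.S.AE_X W.S.AE_X_ne[of "qs ` {1..n}", simplified] AE_ability[of T]
    unfolding x_def f_def by eventually_elim (auto simp: less_imp_le)
  have f01: "AE \<omega> in ?M. \<forall>s\<in>{1..T}. 0 \<le> f \<omega> s \<and> f \<omega> s \<le> 1"
    using good
  proof eventually_elim
    case (elim \<omega>)
    then show ?case using quantile_nonneg quantile_le_one by simp
  qed
  have opt_i: "integrable ?M opt"
  proof (rule W.S.integrable_const_bound[of _ "real T", OF _ opt_m])
    show "AE \<omega> in ?M. norm (opt \<omega>) \<le> real T"
      using f01
    proof eventually_elim
      case (elim \<omega>)
      then show ?case
        unfolding opt_def offline_opt_eq
        using topsum_nonneg[of "{1..T}" B "f \<omega>"] topsum_le_card[of "{1..T}" "f \<omega>" B] by simp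
    qed
  qed
  have rew_i: "integrable ?M rew"
  proof (rule W.S.integrable_const_bound[of _ "real T", OF _ rew_m])
    show "AE \<omega> in ?M. norm (rew \<omega>) \<le> real T"
      using f01
    proof eventually_elim
      case (elim \<omega>)
      have "norm (rew \<omega>) \<le> (\<Sum>t=1..T. norm (f \<omega> t * of_bool (CwG_accepts T B \<epsilon>0 p (x \<omega>) t)))"
        unfolding rew_def by (rule norm_sum)
      also have "\<dots> \<le> of_nat (card {1..T}) * 1" using elim by (intro sum_bounded_above) (auto simp: abs_mult)
      finally show ?case by simp
    qed
  qed
  have ls_i: "integrable ?M (ls t)" if "t \<in> {1..t0}" for t
    by (rule W.S.integrable_const_bound[of _ "modulus (2 * radius t) + 1", OF _ ls_m[OF that]])
       (use step_loss_bounds in \<open>auto simp: ls_def\<close>)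
  have l2_i: "integrable ?M l2"
    by (rule W.S.integrable_const_bound[of _ "real T", OF _ l2_m])
       (use phase2_loss_bounds in \<open>auto simp: l2_def\<close>)
  have sum_i: "integrable ?M (\<lambda>\<omega>. \<Sum>t=1..t0. ls t \<omega>)"
    by (rule Bochner_Integration.integrable_sum) (rule ls_i)
  have "CwG_regret D T B \<epsilon>0 p = (\<integral>\<omega>. opt \<omega> \<partial>?M) - (\<integral>\<omega>. rew \<omega> \<partial>?M)"
    unfolding CwG_regret_def regret_def opt_def rew_def x_def f_def ..
  also have "\<dots> = (\<integral>\<omega>. opt \<omega> - rew \<omega> \<partial>?M)"
    using opt_i rew_i by simp
  also have "\<dots> \<le> (\<integral>\<omega>. (\<Sum>t=1..t0. ls t \<omega>) + l2 \<omega> \<partial>?M)"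
  proof (rule integral_mono_AE)
    show "AE \<omega> in ?M. opt \<omega> - rew \<omega> \<le> (\<Sum>t=1..t0. ls t \<omega>) + l2 \<omega>"
      using good
    proof eventually_elim
      case (elim \<omega>)
      then show ?case
        unfolding opt_def rew_def ls_def l2_def by (intro regret_path) auto
    qed
  qed (intro Bochner_Integration.integrable_diff Bochner_Integration.integrable_add opt_i rew_i sum_i l2_i)+
  also have "\<dots> = (\<Sum>t=1..t0. \<integral>\<omega>. ls t \<omega> \<partial>?M) + (\<integral>\<omega>. l2 \<omega> \<partial>?M)"
    unfolding Bochner_Integration.integral_add[OF sum_i l2_i]
    by (subst Bochner_Integration.integral_sum) (use ls_i in auto)
  also have "\<dots> \<le> (\<Sum>t=1..t0. step_bound t) + sqrt (T - t0)"
    unfolding ls_def l2_def x_def using phase1_length_le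
    by (intro add_mono sum_mono W.expected_step_loss_path W.expected_phase2_loss_path) auto
  finally show ?thesis .
qed

end

section \<open>Power sums\<close>

text \<open>
  Comparison with the integral of \<open>x powr (- s)\<close>, as a telescoping sum: by the mean value theorem
  \<open>(T + 1) powr (1 - s) - T powr (1 - s)\<close> is at least \<open>(1 - s) * (T + 1) powr (- s)\<close>.
\<close>

lemma sum_powr_le:
  fixes s :: real
  assumes s: "0 \<le> s" "s < 1" and T: "1 \<le> T"
  shows "(\<Sum>N=1..T. real N powr (- s)) \<le> real T powr (1 - s) / (1 - s)"
  using T
proof (induction T rule: dec_induct)
  case base
  show ?case using s by simp
next
  case (step T)
  define a where "a = 1 - s"
  have a: "0 < a" "a \<le> 1" using s by (auto simp: a_def)
  have "\<exists>z>real T. z < real (Suc T) \<and>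
      real (Suc T) powr a - real T powr a = (real (Suc T) - real T) * (a * z powr (a - 1))"
    by (rule MVT2) (use step in \<open>auto intro!: derivative_eq_intros\<close>)
  then obtain z where z: "real T < z" "z < real (Suc T)"
    "real (Suc T) powr a - real T powr a = a * z powr (a - 1)" by auto
  have "real (Suc T) powr (a - 1) \<le> z powr (a - 1)"
    using z(1,2) a by (intro powr_mono2') auto
  then have "a * real (Suc T) powr (a - 1) \<le> a * z powr (a - 1)" using a by (intro mult_left_mono) auto
  then have "a * real (Suc T) powr (- s) \<le> real (Suc T) powr a - real T powr a"
    unfolding z(3) by (simp add: a_def)
  then have "(real T powr a + a * real (Suc T) powr (- s)) / a \<le> real (Suc T) powr a / a"
    using a by (intro divide_right_mono) auto
  then have "real T powr a / a + real (Suc T) powr (- s) \<le> real (Suc T) powr a / a"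
    using a by (simp add: add_divide_distrib)
  then show ?case using step.IH step.hyps unfolding a_def[symmetric] by (simp del: of_nat_Suc)
qed

lemma sum_inverse_le:
  assumes T: "1 \<le> T"
  shows "(\<Sum>N=1..T. 1 / real N) \<le> 1 + ln (real T)"
  using T
proof (induction T rule: dec_induct)
  case (step T)
  have "ln (real T / real (Suc T)) \<le> real T / real (Suc T) - 1" using step by (intro ln_le_minus_one) auto
  moreover have "ln (real T / real (Suc T)) = ln (real T) - ln (real (Suc T))" using step by (subst ln_div) auto
  moreover have "real T / real (Suc T) - 1 = - (1 / real (Suc T))" by (simp add: field_simps)
  ultimately have "1 / real (Suc T) \<le> ln (real (Suc T)) - ln (real T)" by linarith
  then show ?case using step.IH step.hyps by (simp del: of_nat_Suc)
qed simp

lemma sum_inverse_squares_le: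
  assumes T: "1 \<le> T"
  shows "(\<Sum>N=1..T. if 2 \<le> N then 2 / (real N)\<^sup>2 else 0) \<le> 2 - 2 / real T"
  using T
proof (induction T rule: dec_induct)
  case (step T)
  have "2 / (real (Suc T))\<^sup>2 \<le> 2 / (real T * real (Suc T))"
    using step by (intro divide_left_mono) (auto simp: power2_eq_square)
  also have "\<dots> = 2 / real T - 2 / real (Suc T)" using step by (simp add: field_simps)
  finally show ?case using step.IH step.hyps by (simp del: of_nat_Suc)
qed simp

text \<open>
  The base equals \<open>sqrt (8 * (ln N / N))\<close>, and \<open>8 powr s \<le> 8\<close>.
\<close>

lemma radius_powr:
  fixes N s :: real
  assumes N: "1 \<le> N" "N \<le> T" and s: "1 / 2 \<le> s" "s \<le> 1"
  shows "(2 * sqrt (2 * ln N / N)) powr (2 * s) \<le> 8 * (ln T powr s * N powr (- s))"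
proof -
  have ln0: "0 \<le> ln N" using N by simp
  have "2 * sqrt (2 * ln N / N) = sqrt 4 * sqrt (2 * ln N / N)" by simp
  also have "\<dots> = sqrt (8 * (ln N / N))" unfolding real_sqrt_mult[symmetric] by simp
  also have "\<dots> = (8 * (ln N / N)) powr (1 / 2)" using ln0 N by (subst powr_half_sqrt) auto
  finally have "(2 * sqrt (2 * ln N / N)) powr (2 * s) = (8 * (ln N / N)) powr s"
    by (simp add: powr_powr)
  also have "\<dots> = 8 powr s * (ln N powr s * N powr (- s))"
    using ln0 N by (simp add: powr_mult powr_divide powr_minus field_simps)
  also have "\<dots> \<le> 8 * (ln T powr s * N powr (- s))"
  proof (rule mult_mono)
    have "(8::real) powr s \<le> 8 powr 1" by (rule powr_mono) (use s in auto)
    then show "(8::real) powr s \<le> 8" by simp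
    have "ln N powr s \<le> ln T powr s" by (rule powr_mono2) (use s ln0 N in auto)
    then show "ln N powr s * N powr (- s) \<le> ln T powr s * N powr (- s)" by (rule mult_right_mono) simp
  qed auto
  finally show ?thesis .
qed

section \<open>Summation of the losses\<close>

context clustered_problem
begin

definition exponent :: real where "exponent = 1 / 2 + 1 / (2 * (\<beta> + 1))"

lemma exponent_bounds: "1 / 2 \<le> exponent" "exponent \<le> 1"
  using beta by (auto simp: exponent_def field_simps)

definition rad :: "nat \<Rightarrow> real" where "rad N = sqrt (2 * ln (real N) / real N)"

text \<open>
  Summation over the number \<open>N\<close> of remaining periods.  The width of the window around the threshold
  and the modulus of continuity combine to the power \<open>1 + 1 / (\<beta> + 1) = 2 * exponent\<close> of the radius.
\<close>

lemma sum_step_bound_le: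
  assumes T: "1 \<le> T"
  shows "(\<Sum>t=1..t0. step_bound t) \<le> 16 * \<bar>C0\<bar> * ln T powr exponent * (\<Sum>N=1..T. real N powr (- exponent))
     + 16 * (\<delta> * sqrt (T * ln T)) + (if 2 \<le> T then 2 else 0)"
proof -
  define g where "g N = modulus (2 * rad N) * (4 * rad N) + (if 2 \<le> N then 2 / (real N)\<^sup>2 else 0)" for N
  have g0: "0 \<le> g N" if "1 \<le> N" for N
    using that modulus_nonneg by (auto simp: g_def rad_def)
  have "(\<Sum>t=1..t0. step_bound t) = (\<Sum>t=1..t0. g (T - t + 1))"
  proof (rule sum.cong[OF refl])
    fix t assume "t \<in> {1..t0}"
    then have "t \<le> T" using phase1_length_le by auto
    then have "radius t = rad (T - t + 1)" unfolding radius_def rad_def by (simp add: of_nat_diff add.commute)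
    then show "step_bound t = g (T - t + 1)"
      unfolding g_def step_bound_def tail_mass_def by simp
  qed
  also have "\<dots> \<le> (\<Sum>t=1..T. g (T - t + 1))"
    using phase1_length_le g0 by (intro sum_mono2) auto
  also have "\<dots> = (\<Sum>N=1..T. g N)"
    by (rule sum.reindex_bij_witness[of _ "\<lambda>N. T - N + 1" "\<lambda>t. T - t + 1"]) auto
  also have "\<dots> \<le> (\<Sum>N=1..T. 16 * \<bar>C0\<bar> * ln T powr exponent * real N powr (- exponent)
      + 8 * \<delta> * sqrt (ln T) * real N powr (- (1/2)) + (if 2 \<le> N then 2 / (real N)\<^sup>2 else 0))"
  proof (rule sum_mono)
    fix N assume N: "N \<in> {1..T}"
    define h where "h = 2 * rad N"
    have h: "0 \<le> h" using N unfolding h_def rad_def by simp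
    have "h powr (1 / (\<beta> + 1)) * h = h powr (2 * exponent)"
    proof (cases "h = 0")
      case False
      then have "h powr (1 / (\<beta> + 1)) * h = h powr (1 / (\<beta> + 1)) * h powr 1" using h by simp
      also have "\<dots> = h powr (1 / (\<beta> + 1) + 1)" by (rule powr_add[symmetric])
      also have "1 / (\<beta> + 1) + 1 = 2 * exponent" using beta unfolding exponent_def by (simp add: field_simps)
      finally show ?thesis .
    qed simp
    also have "\<dots> \<le> 8 * (ln T powr exponent * real N powr (- exponent))"
      unfolding h_def rad_def by (rule radius_powr) (use N exponent_bounds in auto)
    finally have A: "h powr (1 / (\<beta> + 1)) * h \<le> 8 * (ln T powr exponent * real N powr (- exponent))" .
    have B: "h \<le> 4 * (sqrt (ln T) * real N powr (- (1/2)))"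
    proof -
      have "h = 2 * sqrt 2 * (sqrt (ln N) / sqrt N)"
        unfolding h_def rad_def by (simp add: real_sqrt_mult real_sqrt_divide)
      also have "\<dots> \<le> 2 * 2 * (sqrt (ln T) / sqrt N)"
      proof (intro mult_mono divide_right_mono)
        show "sqrt 2 \<le> (2::real)" by (rule real_le_lsqrt) auto
        show "sqrt (ln N) \<le> sqrt (ln T)" using N by simp
      qed (use N in auto)
      also have "\<dots> = 4 * (sqrt (ln T) * real N powr (- (1/2)))"
      proof -
        have "0 \<le> real N" by simp
        then have "real N powr (- (1/2)) = 1 / sqrt N" by (simp only: powr_minus_divide powr_half_sqrt)
        then show ?thesis by simp
      qed
      finally show ?thesis .
    qed
    have "modulus (2 * rad N) * (4 * rad N) = 2 * \<bar>C0\<bar> * (h powr (1 / (\<beta> + 1)) * h) + 2 * \<delta> * h"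
      unfolding modulus_def h_def[symmetric] by (simp add: h_def algebra_simps)
    also have "\<dots> \<le> 2 * \<bar>C0\<bar> * (8 * (ln T powr exponent * real N powr (- exponent)))
        + 2 * \<delta> * (4 * (sqrt (ln T) * real N powr (- (1/2))))"
      using A B delta by (intro add_mono mult_left_mono) auto
    finally show "g N \<le> 16 * \<bar>C0\<bar> * ln T powr exponent * real N powr (- exponent)
      + 8 * \<delta> * sqrt (ln T) * real N powr (- (1/2)) + (if 2 \<le> N then 2 / (real N)\<^sup>2 else 0)"
      unfolding g_def by (simp add: mult_ac)
  qed
  also have "\<dots> = 16 * \<bar>C0\<bar> * ln T powr exponent * (\<Sum>N=1..T. real N powr (- exponent))
      + 8 * \<delta> * sqrt (ln T) * (\<Sum>N=1..T. real N powr (- (1/2)))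
      + (\<Sum>N=1..T. if 2 \<le> N then 2 / (real N)\<^sup>2 else 0)"
    by (simp only: sum.distrib sum_distrib_left)
  also have "\<dots> \<le> 16 * \<bar>C0\<bar> * ln T powr exponent * (\<Sum>N=1..T. real N powr (- exponent))
     + 16 * (\<delta> * sqrt (T * ln T)) + (if 2 \<le> T then 2 else 0)"
  proof (intro add_mono order_refl)
    have "8 * \<delta> * sqrt (ln T) * (\<Sum>N=1..T. real N powr (- (1/2))) \<le> 8 * \<delta> * sqrt (ln T) * (real T powr (1 - 1/2) / (1 - 1/2))"
      using delta T by (intro mult_left_mono sum_powr_le) auto
    also have "\<dots> = 16 * (\<delta> * sqrt (T * ln T))"
      by (simp add: powr_half_sqrt real_sqrt_mult)
    finally show "8 * \<delta> * sqrt (ln T) * (\<Sum>N=1..T. real N powr (- (1/2))) \<le> 16 * (\<delta> * sqrt (T * ln T))" .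
    have "2 - 2 / real T \<le> (if 2 \<le> T then 2 else 0)"
      using T by (cases "T = 1") auto
    then show "(\<Sum>N=1..T. if 2 \<le> N then 2 / (real N)\<^sup>2 else 0) \<le> (if 2 \<le> T then 2 else (0::real))"
      using sum_inverse_squares_le[OF T] by linarith
  qed
  finally show ?thesis .
qed

lemma phase2_sqrt_le: "sqrt (T - t0) \<le> 8 * sqrt (ln (1 / \<epsilon>0)) / \<epsilon>0"
proof -
  have "sqrt (T - t0) \<le> sqrt (64 * ln (1 / \<epsilon>0) / \<epsilon>0\<^sup>2)" using phase2_length_le by simp
  also have "\<dots> = 8 * sqrt (ln (1 / \<epsilon>0)) / \<epsilon>0"
    using eps real_sqrt_abs[of 8] by (simp add: real_sqrt_mult real_sqrt_divide)
  finally show ?thesis .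
qed

text \<open>
  For \<open>\<beta> > 0\<close> the power sum has exponent below \<open>1\<close> and contributes the factor
  \<open>1 / (1 - exponent) = 2 * (1 + 1 / \<beta>)\<close>; for \<open>\<beta> = 0\<close> it is a harmonic sum and contributes another
  logarithm.  The additive constant \<open>2\<close> from the bad paths is present only for \<open>T \<ge> 2\<close>, where
  \<open>ln T \<ge> 1/2\<close> lets the leading term absorb it.
\<close>

theorem CwG_regret_bound:
  assumes T: "1 \<le> T" and C: "C = 48 * \<bar>C0\<bar> + 16"
  shows "CwG_regret D T B \<epsilon>0 p \<le>
      C * (1 + 1 / \<beta>) * ln (real T) powr (1/2 + 1 / (2 * (\<beta> + 1)))
        * real T powr (1/2 - 1 / (2 * (\<beta> + 1))) * of_bool (\<beta> > 0)
      + C * (ln (real T))\<^sup>2 * of_bool (\<beta> = 0)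
      + C * \<delta> * sqrt (real T * ln (real T))
      + C * sqrt (ln (1 / \<epsilon>0)) / \<epsilon>0"
proof -
  have C16: "16 \<le> C" unfolding C by simp
  have ln2: "1 / 2 \<le> ln (2::real)" using ln2_ge_two_thirds by simp
  have lnT: "1 / 2 \<le> ln (real T)" if "2 \<le> T"
  proof -
    have "ln 2 \<le> ln (real T)" using that by simp
    then show ?thesis using ln2 by linarith
  qed
  have lnT0: "0 \<le> ln (real T)" using T by simp
  have main: "16 * \<bar>C0\<bar> * ln T powr exponent * (\<Sum>N=1..T. real N powr (- exponent)) + (if 2 \<le> T then 2 else 0)
    \<le> C * (1 + 1 / \<beta>) * ln (real T) powr (1/2 + 1 / (2 * (\<beta> + 1)))
        * real T powr (1/2 - 1 / (2 * (\<beta> + 1))) * of_bool (\<beta> > 0)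
      + C * (ln (real T))\<^sup>2 * of_bool (\<beta> = 0)"
  proof (cases "\<beta> = 0")
    case True
    have e: "exponent = 1" using exponent_def by (simp add: True)
    have "(\<Sum>N=1..T. real N powr (- exponent)) = (\<Sum>N=1..T. 1 / real N)"
      unfolding e by (rule sum.cong) (auto simp: powr_minus powr_one divide_inverse)
    then have S: "(\<Sum>N=1..T. real N powr (- exponent)) \<le> 1 + ln (real T)" using sum_inverse_le[OF T] by simp
    show ?thesis
    proof (cases "2 \<le> T")
      case False
      then have "T = 1" using T by simp
      then show ?thesis using True e by simp
    next
      case T2: True
      have "16 * \<bar>C0\<bar> * ln T powr exponent * (\<Sum>N=1..T. real N powr (- exponent))
          \<le> 16 * \<bar>C0\<bar> * ln T * (1 + ln T)"
        using S lnT0 lnT[OF T2] unfolding e by (intro mult_mono) (auto intro!: sum_nonneg)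
      also have "\<dots> \<le> 16 * \<bar>C0\<bar> * ln T * (3 * ln T)"
        using lnT[OF T2] lnT0 by (intro mult_left_mono) auto
      finally have A: "16 * \<bar>C0\<bar> * ln T powr exponent * (\<Sum>N=1..T. real N powr (- exponent)) \<le> 48 * \<bar>C0\<bar> * (ln T)\<^sup>2"
        by (simp add: power2_eq_square)
      have "(1/2)\<^sup>2 \<le> (ln (real T))\<^sup>2" using lnT[OF T2] by (intro power_mono) auto
      then have "2 \<le> 16 * (ln (real T))\<^sup>2" by (simp add: power2_eq_square)
      then have "16 * \<bar>C0\<bar> * ln T powr exponent * (\<Sum>N=1..T. real N powr (- exponent)) + 2 \<le> C * (ln T)\<^sup>2"
        using A unfolding C by (simp add: algebra_simps)
      then show ?thesis using True T2 by simp
    qed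
  next
    case False
    then have b: "0 < \<beta>" using beta by simp
    define R where "R = (1 + 1 / \<beta>) * (ln T powr exponent * real T powr (1 - exponent))"
    have e1: "1 - exponent = \<beta> / (2 * (\<beta> + 1))" using b unfolding exponent_def by (simp add: field_simps)
    moreover have "0 < \<beta> / (2 * (\<beta> + 1))" using b by simp
    ultimately have lt: "exponent < 1" by linarith
    have inv: "1 / (1 - exponent) = 2 * (1 + 1 / \<beta>)" unfolding e1 using b by (simp add: field_simps)
    have "(\<Sum>N=1..T. real N powr (- exponent)) \<le> real T powr (1 - exponent) / (1 - exponent)"
      by (rule sum_powr_le) (use exponent_bounds lt T in auto)
    also have "\<dots> = real T powr (1 - exponent) * (2 * (1 + 1 / \<beta>))" unfolding inv[symmetric] by simp
    finally have "16 * \<bar>C0\<bar> * ln T powr exponent * (\<Sum>N=1..T. real N powr (- exponent))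
        \<le> 16 * \<bar>C0\<bar> * ln T powr exponent * (real T powr (1 - exponent) * (2 * (1 + 1 / \<beta>)))"
      by (intro mult_left_mono) auto
    also have "\<dots> = 32 * \<bar>C0\<bar> * R" unfolding R_def by (simp add: mult_ac)
    finally have A: "16 * \<bar>C0\<bar> * ln T powr exponent * (\<Sum>N=1..T. real N powr (- exponent)) \<le> 32 * \<bar>C0\<bar> * R" .
    have R0: "0 \<le> R" using b unfolding R_def by simp
    have "(if 2 \<le> T then 2 else 0) \<le> 16 * R"
    proof (cases "2 \<le> T")
      case True
      have "1 / 2 \<le> (1/2::real) powr exponent"
        using powr_mono'[of exponent 1 "1/2::real"] exponent_bounds by simp
      also have "\<dots> \<le> ln T powr exponent" using lnT[OF True] exponent_bounds by (intro powr_mono2) auto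
      finally have l: "1 / 2 \<le> ln T powr exponent" .
      have "1 \<le> real T powr (1 - exponent)" using lt T by (intro ge_one_powr_ge_zero) auto
      with l have prod: "1 / 2 * 1 \<le> ln T powr exponent * real T powr (1 - exponent)"
        by (rule mult_mono) auto
      have "1 \<le> 1 + 1 / \<beta>" using b by simp
      then have "1 * (1 / 2 * 1) \<le> R" unfolding R_def by (rule mult_mono[OF _ prod]) (use b in auto)
      then show ?thesis by simp
    qed (use R0 in simp)
    then have "16 * \<bar>C0\<bar> * ln T powr exponent * (\<Sum>N=1..T. real N powr (- exponent)) + (if 2 \<le> T then 2 else 0)
        \<le> 32 * \<bar>C0\<bar> * R + 16 * R" using A by linarith
    also have "\<dots> \<le> C * R" unfolding C using R0 by (simp add: algebra_simps mult_right_mono)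
    also have "1 - exponent = 1/2 - 1 / (2 * (\<beta> + 1))" unfolding exponent_def by simp
    then have "C * R = C * (1 + 1 / \<beta>) * ln (real T) powr (1/2 + 1 / (2 * (\<beta> + 1)))
        * real T powr (1/2 - 1 / (2 * (\<beta> + 1)))"
      unfolding R_def by (simp add: exponent_def mult_ac)
    finally show ?thesis using b by simp
  qed
  have d0: "0 \<le> \<delta> * sqrt (T * ln T)" using delta lnT0 by simp
  have "16 * (\<delta> * sqrt (T * ln T)) \<le> C * (\<delta> * sqrt (T * ln T))" using C16 d0 by (rule mult_right_mono)
  moreover have "8 * sqrt (ln (1 / \<epsilon>0)) / \<epsilon>0 \<le> C * sqrt (ln (1 / \<epsilon>0)) / \<epsilon>0"
    using C16 eps by (intro divide_right_mono mult_right_mono) auto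
  ultimately show ?thesis
    using CwG_regret_le[of B] sum_step_bound_le[OF T] phase2_sqrt_le main by (simp add: mult.assoc)
qed

end

theorem theorem2:
  fixes C0 :: real
  shows "\<exists>C::real. \<forall>(\<beta>::real) (\<epsilon>0::real) (\<delta>::real) (D::real measure) (n::nat) (qs::nat \<Rightarrow> real)
      (T::nat) (B::nat) (p::nat \<Rightarrow> nat \<Rightarrow> real).
    \<beta> \<ge> 0 \<and> \<epsilon>0 \<in> {0<..1} \<and> \<delta> \<in> {0..1} \<and>
    real_distribution D \<and> measure D {0..1} = 1 \<and>
    clustered_with C0 \<beta> \<epsilon>0 \<delta> D n qs \<and>
    B \<in> {1..T} \<and> CwG_threshold_rule T n qs p
    \<longrightarrow>
    CwG_regret D T B \<epsilon>0 p \<le>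
      C * (1 + 1 / \<beta>) * ln (real T) powr (1/2 + 1 / (2 * (\<beta> + 1)))
        * real T powr (1/2 - 1 / (2 * (\<beta> + 1))) * of_bool (\<beta> > 0)
      + C * (ln (real T))\<^sup>2 * of_bool (\<beta> = 0)
      + C * \<delta> * sqrt (real T * ln (real T))
      + C * sqrt (ln (1 / \<epsilon>0)) / \<epsilon>0"
proof (intro exI allI impI, elim conjE)
  fix \<beta> \<epsilon>0 \<delta> :: real and D :: "real measure" and n :: nat and qs :: "nat \<Rightarrow> real" and T B :: nat
    and p :: "nat \<Rightarrow> nat \<Rightarrow> real"
  assume *: "\<beta> \<ge> 0" "\<epsilon>0 \<in> {0<..1}" "\<delta> \<in> {0..1}" "real_distribution D" "measure D {0..1} = 1"
    "clustered_with C0 \<beta> \<epsilon>0 \<delta> D n qs" "B \<in> {1..T}" "CwG_threshold_rule T n qs p"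
  interpret clustered_problem D C0 \<beta> \<epsilon>0 \<delta> n qs T p
    using * by (auto simp: clustered_problem_def clustered_problem_axioms_def unit_distribution_def unit_distribution_axioms_def)
  show "CwG_regret D T B \<epsilon>0 p \<le>
      (48 * \<bar>C0\<bar> + 16) * (1 + 1 / \<beta>) * ln (real T) powr (1/2 + 1 / (2 * (\<beta> + 1)))
        * real T powr (1/2 - 1 / (2 * (\<beta> + 1))) * of_bool (\<beta> > 0)
      + (48 * \<bar>C0\<bar> + 16) * (ln (real T))\<^sup>2 * of_bool (\<beta> = 0)
      + (48 * \<bar>C0\<bar> + 16) * \<delta> * sqrt (real T * ln (real T))
      + (48 * \<bar>C0\<bar> + 16) * sqrt (ln (1 / \<epsilon>0)) / \<epsilon>0"
    by (rule CwG_regret_bound) (use * in auto)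
qed

end
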